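(* Let $T$ be a finite tree with vertex set $V$, incidence relation $C$ and tree ideal $I(T)\subseteq k[x_C]$. There is a one-to-one correspondence, given by $Q\leftrightarrow L(Q)$, between regular linear spaces for $k[x_C]/I(T)$ giving squarefree quotient rings, and partitions $Q$ of $V$ into sets of independent vertices.
   Context: Let $k$ be a field and $T$ a finite tree with vertex set $V$ and edge set $E$ (edges are two-element subsets of $V$). The incidence relation is $C=\{(e,v)\in E\times V \mid v\in e\}$, and $k[x_C]$ is the polynomial ring in the variables $x_{e,v}$, $(e,v)\in C$. For distinct $v,w\in V$ let $vTw$ be the unique path from $v$ to $w$ in $T$, let $e=\{v,v'\}$ be the edge on this path incident to $v$ and $f=\{w,w'\}$ the edge on this path incident to $w$ (possibly $e=f$). The tree ideal $I(T)\subseteq k[x_C]$ is generated by the monomials $m_{v,w}=x_{e,v}x_{f,w}$ over all pairs of distinct vertices $v,w$. Put $h_{v,w}=x_{e,v'}-x_{f,w'}$; then $h_{w,v}=-h_{v,w}$. A variable difference is a difference of two distinct variables of $k[x_C]$. A linear subspace $L$ of the space of linear forms $\langle x_{e,v}\rangle_{(e,v)\in C}$ is a regular linear space for $k[x_C]/I(T)$ if it has a basis which is a regular sequence of variable differences for $k[x_C]/I(T)$ (the zero space, with empty basis, is included). Dividing out by such an $L$ identifies variables, so $k[x_C]/(I(T)+(L))$ is the quotient of the polynomial ring $k[x_C]/(L)$ by a monomial ideal; $L$ gives a squarefree quotient ring if this monomial ideal is squarefree. A sequence of vertices $v,u,w$ is $T$-aligned if $u$ is on the path $vTw$. Let $U\subseteq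 V$ be nonempty and $S$ a tree with vertex set $U$ (a priori unrelated to $T$). $S$ flows with $T$ if whenever $v,u,w\in U$ are $T$-aligned, then $v,u,w$ are $S$-aligned. $L(S)$ denotes the linear span of the $h_{v,w}$ for $\{v,w\}$ an edge of $S$. For every nonempty $U\subseteq V$ there is a tree $S$ on $U$ flowing with $T$, and $L(S)$ is the same for all such $S$; it is denoted $L(U)$. For a partition $Q:U_0\sqcup\cdots\sqcup U_r$ of $V$, $L(Q)=L(U_0)\oplus\cdots\oplus L(U_r)$. A set of vertices is independent if no two of its elements are joined by an edge of $T$. *)

theory Defs
  imports
    "HOL.Vector_Spaces"
    "HOL-Library.Poly_Mapping"
    "HOL-Library.Disjoint_Sets"
    "HOL-Algebra.QuotRing"
begin

section \<open>Trees\<close>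

definition graph_path :: "'v set \<Rightarrow> 'v set set \<Rightarrow> 'v \<Rightarrow> 'v \<Rightarrow> 'v list \<Rightarrow> bool" where
  "graph_path V E v w p \<longleftrightarrow>
     p \<noteq> [] \<and> hd p = v \<and> last p = w \<and> set p \<subseteq> V \<and> distinct p \<and>
     successively (\<lambda>a b. {a, b} \<in> E) p"

definition graph_cycle :: "'v set \<Rightarrow> 'v set set \<Rightarrow> 'v list \<Rightarrow> bool" where
  "graph_cycle V E p \<longleftrightarrow>
     3 \<le> length p \<and> set p \<subseteq> V \<and> distinct p \<and>
     successively (\<lambda>a b. {a, b} \<in> E) p \<and> {last p, hd p} \<in> E"

definition finite_tree :: "'v set \<Rightarrow> 'v set set \<Rightarrow> bool" where
  "finite_tree V E \<longleftrightarrow>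
     finite V \<and> V \<noteq> {} \<and> E \<subseteq> {e. e \<subseteq> V \<and> card e = 2} \<and>
     (\<forall>v\<in>V. \<forall>w\<in>V. \<exists>p. graph_path V E v w p) \<and>
     (\<nexists>p. graph_cycle V E p)"

text \<open>The unique path \<open>vTw\<close>, listed from \<open>v\<close> to \<open>w\<close>.\<close>

definition tree_path :: "'v set \<Rightarrow> 'v set set \<Rightarrow> 'v \<Rightarrow> 'v \<Rightarrow> 'v list" where
  "tree_path V E v w = (THE p. graph_path V E v w p)"

definition aligned :: "'v set \<Rightarrow> 'v set set \<Rightarrow> 'v \<Rightarrow> 'v \<Rightarrow> 'v \<Rightarrow> bool" where
  "aligned V E v u w \<longleftrightarrow> u \<in> set (tree_path V E v w)"

text \<open>For distinct \<open>v\<close>, \<open>w\<close> this is the neighbour \<open>v'\<close> of \<open>v\<close> on \<open>vTw\<close>, so that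
  \<open>e = {v, v'}\<close>. As \<open>wTv\<close> is \<open>vTw\<close> reversed, \<open>w'\<close> is obtained by swapping the
  arguments.\<close>

definition step_to :: "'v set \<Rightarrow> 'v set set \<Rightarrow> 'v \<Rightarrow> 'v \<Rightarrow> 'v" where
  "step_to V E v w = tree_path V E v w ! 1"

definition independent_set :: "'v set set \<Rightarrow> 'v set \<Rightarrow> bool" where
  "independent_set E U \<longleftrightarrow> (\<forall>v\<in>U. \<forall>w\<in>U. {v, w} \<notin> E)"


section \<open>Polynomial rings and linear forms\<close>

text \<open>A monomial is its finitely supported exponent function, a polynomial is the finitely
  supported function of its coefficients; multiplication is convolution.\<close>

type_synonym ('x, 'k) mpoly = "('x \<Rightarrow>\<^sub>0 nat) \<Rightarrow>\<^sub>0 'k"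

definition pvar :: "'x \<Rightarrow> ('x, 'k::field) mpoly" where
  "pvar c = Poly_Mapping.single (Poly_Mapping.single c 1) 1"

text \<open>The ring \<open>k[x\<^sub>c | c \<in> C]\<close>: only the variables in \<open>C\<close> may occur.\<close>

definition poly_ring :: "'x set \<Rightarrow> ('x, 'k::field) mpoly ring" where
  "poly_ring C =
     \<lparr>carrier = {p. \<forall>m \<in> Poly_Mapping.keys p. Poly_Mapping.keys m \<subseteq> C},
      mult = (*), one = 1, zero = 0, add = (+)\<rparr>"

definition poly_scale :: "'k \<Rightarrow> ('x, 'k::field) mpoly \<Rightarrow> ('x, 'k) mpoly" where
  "poly_scale a p = Poly_Mapping.single 0 a * p"

interpretation lin: vector_space poly_scale
  by unfold_locales
    (simp_all add: poly_scale_def algebra_simps single_add mult_single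
      flip: mult.assoc)

lemma poly_ring_cring: "cring (poly_ring C)"
proof -
  have sum: "x + y \<in> carrier (poly_ring C)"
    if "x \<in> carrier (poly_ring C)" "y \<in> carrier (poly_ring C)"
    for x y :: "('a, 'b) mpoly"
    using that Poly_Mapping.keys_add[of x y] by (fastforce simp: poly_ring_def)
  have neg: "- x \<in> carrier (poly_ring C)" if "x \<in> carrier (poly_ring C)"
    for x :: "('a, 'b) mpoly"
    using that by (simp add: poly_ring_def)
  have prod: "x * y \<in> carrier (poly_ring C)"
    if "x \<in> carrier (poly_ring C)" "y \<in> carrier (poly_ring C)"
    for x y :: "('a, 'b) mpoly"
  proof -
    have "Poly_Mapping.keys m \<subseteq> C" if m: "m \<in> Poly_Mapping.keys (x * y)" for m
    proof -
      obtain a b where "m = a + b" "a \<in> Poly_Mapping.keys x" "b \<in> Poly_Mapping.keys y"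
        using m keys_mult[of x y] by blast
      then show ?thesis
        using \<open>x \<in> _\<close> \<open>y \<in> _\<close> Poly_Mapping.keys_add[of a b] by (fastforce simp: poly_ring_def)
    qed
    then show ?thesis by (simp add: poly_ring_def)
  qed
  have R: "x \<oplus>\<^bsub>poly_ring C\<^esub> y = x + y" "x \<otimes>\<^bsub>poly_ring C\<^esub> y = x * y"
    "\<one>\<^bsub>poly_ring C\<^esub> = 1" "\<zero>\<^bsub>poly_ring C\<^esub> = 0" for x y :: "('a, 'b) mpoly"
    by (simp_all add: poly_ring_def)
  have zero: "(0 :: ('a, 'b) mpoly) \<in> carrier (poly_ring C)"
    by (simp add: poly_ring_def)
  have one: "(1 :: ('a, 'b) mpoly) \<in> carrier (poly_ring C)"
    by (simp add: poly_ring_def)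
  show ?thesis
  proof (rule cringI)
    show "abelian_group (poly_ring C :: ('a, 'b) mpoly ring)"
      by (rule abelian_groupI)
        (auto simp: R add_ac intro: sum zero bexI[OF _ neg])
    show "comm_monoid (poly_ring C :: ('a, 'b) mpoly ring)"
      by (rule comm_monoidI) (auto simp: R mult_ac intro: prod one)
  qed (simp add: R distrib_right)
qed


section \<open>Regular linear spaces\<close>

text \<open>Regular sequences on \<open>R/I\<close>: each \<open>f\<^sub>i\<close> is a nonzerodivisor on
  \<open>R/(I + (f\<^sub>0, \<dots>, f\<^sub>i\<^sub>-\<^sub>1))\<close>, and the final quotient is nonzero.\<close>

definition nonzerodivisor :: "('a, 'b) ring_scheme \<Rightarrow> 'a \<Rightarrow> bool" where
  "nonzerodivisor A a \<longleftrightarrow>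
     a \<in> carrier A \<and> (\<forall>b \<in> carrier A. a \<otimes>\<^bsub>A\<^esub> b = \<zero>\<^bsub>A\<^esub> \<longrightarrow> b = \<zero>\<^bsub>A\<^esub>)"

definition regular_sequence :: "('a, 'b) ring_scheme \<Rightarrow> 'a set \<Rightarrow> 'a list \<Rightarrow> bool" where
  "regular_sequence R I fs \<longleftrightarrow>
     set fs \<subseteq> carrier R \<and>
     (\<forall>i < length fs. let J = Idl\<^bsub>R\<^esub> (I \<union> set (take i fs))
                      in nonzerodivisor (R Quot J) (J +>\<^bsub>R\<^esub> (fs ! i))) \<and>
     Idl\<^bsub>R\<^esub> (I \<union> set fs) \<noteq> carrier R"

definition variable_differences :: "'x set \<Rightarrow> ('x, 'k::field) mpoly set" where
  "variable_differences C = {pvar c - pvar d | c d. c \<in> C \<and> d \<in> C \<and> c \<noteq> d}"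

definition regular_linear_space ::
  "'x set \<Rightarrow> ('x, 'k::field) mpoly set \<Rightarrow> ('x, 'k) mpoly set \<Rightarrow> bool" where
  "regular_linear_space C I L \<longleftrightarrow>
     lin.subspace L \<and> L \<subseteq> lin.span (pvar ` C) \<and>
     (\<exists>fs. distinct fs \<and> lin.independent (set fs) \<and> lin.span (set fs) = L \<and>
           set fs \<subseteq> variable_differences C \<and>
           regular_sequence (poly_ring C) I fs)"

text \<open>If \<open>L\<close> is spanned by variable differences, \<open>B = k[x\<^sub>C]/(L)\<close> is the polynomial ring
  in the \<^emph>\<open>distinct\<close> classes \<open>Y\<close> of the variables, and its squarefree monomials are the
  products of the subsets of \<open>Y\<close>. The image of \<open>I\<close> in \<open>B\<close> is required to be generated by
  such monomials.\<close>

definition squarefree_quotient ::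
  "'x set \<Rightarrow> ('x, 'k::field) mpoly set \<Rightarrow> ('x, 'k) mpoly set \<Rightarrow> bool" where
  "squarefree_quotient C I L \<longleftrightarrow>
     (let R = poly_ring C;
          J = Idl\<^bsub>R\<^esub> L;
          B = R Quot J;
          Y = (\<lambda>c. J +>\<^bsub>R\<^esub> pvar c) ` C
      in \<exists>M \<subseteq> {finprod B (\<lambda>y. y) A | A. A \<subseteq> Y}.
           (\<lambda>f. J +>\<^bsub>R\<^esub> f) ` I = Idl\<^bsub>B\<^esub> M)"


section \<open>The tree ideal and the spaces \<open>L(U)\<close> and \<open>L(Q)\<close>\<close>

definition incidence :: "'v set \<Rightarrow> 'v set set \<Rightarrow> ('v set \<times> 'v) set" where
  "incidence V E = {(e, v) \<in> E \<times> V. v \<in> e}"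

definition tree_monomial ::
  "'v set \<Rightarrow> 'v set set \<Rightarrow> 'v \<Rightarrow> 'v \<Rightarrow> ('v set \<times> 'v, 'k::field) mpoly" where
  "tree_monomial V E v w =
     (let e = {v, step_to V E v w}; f = {w, step_to V E w v}
      in pvar (e, v) * pvar (f, w))"

definition tree_ideal :: "'v set \<Rightarrow> 'v set set \<Rightarrow> ('v set \<times> 'v, 'k::field) mpoly set" where
  "tree_ideal V E =
     Idl\<^bsub>poly_ring (incidence V E)\<^esub>
       {tree_monomial V E v w | v w. v \<in> V \<and> w \<in> V \<and> v \<noteq> w}"

definition tree_difference ::
  "'v set \<Rightarrow> 'v set set \<Rightarrow> 'v \<Rightarrow> 'v \<Rightarrow> ('v set \<times> 'v, 'k::field) mpoly" where
  "tree_difference V E v w =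
     (let v' = step_to V E v w; w' = step_to V E w v
      in pvar ({v, v'}, v') - pvar ({w, w'}, w'))"

definition flows_with :: "'v set \<Rightarrow> 'v set set \<Rightarrow> 'v set \<Rightarrow> 'v set set \<Rightarrow> bool" where
  "flows_with V E U S \<longleftrightarrow>
     (\<forall>v\<in>U. \<forall>u\<in>U. \<forall>w\<in>U. aligned V E v u w \<longrightarrow> aligned U S v u w)"

definition L_tree ::
  "'v set \<Rightarrow> 'v set set \<Rightarrow> 'v set set \<Rightarrow> ('v set \<times> 'v, 'k::field) mpoly set" where
  "L_tree V E S = lin.span {tree_difference V E v w | v w. {v, w} \<in> S}"

definition L_set ::
  "'v set \<Rightarrow> 'v set set \<Rightarrow> 'v set \<Rightarrow> ('v set \<times> 'v, 'k::field) mpoly set" where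
  "L_set V E U =
     (THE L. \<exists>S. finite_tree U S \<and> flows_with V E U S \<and> L = L_tree V E S)"

text \<open>The sum of the subspaces \<open>L(U)\<close>; it is in fact direct.\<close>

definition L_partition ::
  "'v set \<Rightarrow> 'v set set \<Rightarrow> 'v set set \<Rightarrow> ('v set \<times> 'v, 'k::field) mpoly set" where
  "L_partition V E Q = lin.span (\<Union>U\<in>Q. L_set V E U)"

end

theory Submission
  imports Defs
begin

text \<open>
  A variable \<open>x\<^bsub>e,y\<^esub>\<close> with \<open>e = {y, v}\<close> is viewed as an arrow \<open>y \<rightarrow> v\<close>. The tree ideal is the edge
  ideal of the graph in which two arrows are adjacent if they face each other, and \<open>h\<^bsub>v,w\<^esub>\<close> is the
  difference of two arrows, with heads \<open>v\<close> and \<open>w\<close>, that point away from each other (``outward''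
  arrows).

  Algebra. A space \<open>L\<close> spanned by variable differences amounts to an equivalence relation on the
  variables, and modulo \<open>L\<close> the ideal becomes the edge ideal of the quotient graph
  (\<open>mem_ideal_iff\<close>). The quotient is squarefree iff no edge becomes a loop
  (\<open>squarefree_quotient_iff\<close>). In the absence of loops, \<open>x\<^sub>a - x\<^sub>b\<close> is a nonzerodivisor iff in the
  quotient graph every neighbour of \<open>a\<close> is adjacent to every neighbour of \<open>b\<close>
  (\<open>variable_difference_nonzerodivisor\<close>, \<open>ident_nonzerodivisorD\<close>).

  From partitions to spaces. Let the blocks of \<open>Q\<close> be independent. Then \<open>L(Q)\<close> identifies two arrows
  iff their heads lie in one block \<open>U\<close> and their tails are connected in the complement of \<open>U\<close>
  (\<open>L_set_eq\<close>, \<open>L_partition_eq\<close>). Distinct identified arrows are outward and not facing. If two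
  arrows are outward, then every neighbour of one faces every neighbour of the other already in the tree
  (\<open>outward_neighbours_facing\<close>), so every basis of \<open>L(Q)\<close> consisting of variable differences is a
  regular sequence, in any order.

  From spaces to partitions. Conversely, for a regular sequence with squarefree quotient, induction on
  its length shows that identified arrows are outward (\<open>regular_outward\<close>), because two arrows that are
  not outward have neighbours that remain nonadjacent (\<open>outward_if_neighbours_facing\<close>). Joining
  vertices that are heads of identified arrows generates a partition of the vertices. A chain of such
  joins, once shortened, follows a path of the tree; from this one reads off that the blocks are
  independent and that the identifications are those of the partition (\<open>partition_of_relation\<close>).

  Injectivity. Consecutive vertices of a block along a path are heads of identified arrows, so the
  identifications determine the blocks (\<open>partition_rel_determines_blocks\<close>).
\<close>

section \<open>Paths in trees\<close>

lemma walk_to_path: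
  assumes "successively (\<lambda>a b. {a, b} \<in> E) p" "p \<noteq> []"
  shows "\<exists>q. q \<noteq> [] \<and> hd q = hd p \<and> last q = last p \<and> set q \<subseteq> set p \<and> distinct q \<and>
    successively (\<lambda>a b. {a, b} \<in> E) q"
  using assms
proof (induction p)
  case (Cons x p)
  show ?case
  proof (cases "p = []")
    case True
    then show ?thesis by (intro exI[of _ "[x]"]) auto
  next
    case False
    with Cons obtain q where q: "q \<noteq> []" "hd q = hd p" "last q = last p" "set q \<subseteq> set p"
      "distinct q" "successively (\<lambda>a b. {a, b} \<in> E) q"
      by (auto simp: successively_Cons)
    show ?thesis
    proof (cases "x \<in> set q")
      case True
      then obtain q1 q2 where "q = q1 @ x # q2" by (auto simp: in_set_conv_decomp)
      with q False show ?thesis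
        by (intro exI[of _ "x # q2"]) (auto simp: successively_append_iff)
    next
      case F: False
      with q False Cons.prems show ?thesis
        by (intro exI[of _ "x # q"]) (auto simp: successively_Cons)
    qed
  qed
qed simp

lemma graph_path_rev: "graph_path V E v w p \<Longrightarrow> graph_path V E w v (rev p)"
  by (auto simp: graph_path_def hd_rev last_rev insert_commute)

lemma graph_path_ConsD:
  assumes "graph_path V E v w (x # p)" "p \<noteq> []"
  shows "x = v" "{v, hd p} \<in> E" "v \<notin> set p" "graph_path V E (hd p) w p"
  using assms by (auto simp: graph_path_def successively_Cons)

lemma graph_path_unique:
  assumes "\<nexists>p. graph_cycle V E p" "graph_path V E v w p" "graph_path V E v w q"
  shows "p = q"
  using assms(2,3)
proof (induction p arbitrary: v q)
  case Nil
  then show ?case by (simp add: graph_path_def)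
next
  case (Cons x p)
  obtain q' where q': "q = x # q'"
    using Cons.prems by (cases q) (auto simp: graph_path_def)
  show ?case
  proof (cases "p = [] \<or> q' = []")
    case True
    with Cons.prems q' show ?thesis
      by (auto simp: graph_path_def split: if_splits)
  next
    case False
    note P = graph_path_ConsD[OF Cons.prems(1)]
    note Q = graph_path_ConsD[OF Cons.prems(2)[unfolded q']]
    have "hd p = hd q'"
    proof (rule ccontr)
      assume ne: "hd p \<noteq> hd q'"
      define r where "r = p @ tl (rev q')"
      have lst: "last p = last q'" using P(4) Q(4) False by (auto simp: graph_path_def)
      have sr: "successively (\<lambda>a b. {a, b} \<in> E) (rev q')"
        using Q(4) False by (auto simp: graph_path_def insert_commute)
      have rq: "rev q' = last q' # tl (rev q')"
        using False by (metis hd_Cons_tl hd_rev rev_is_Nil_conv)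
      have r_walk: "successively (\<lambda>a b. {a, b} \<in> E) r"
        using sr P(4) False lst unfolding r_def graph_path_def
        by (subst (asm) rq) (auto simp: successively_append_iff successively_Cons)
      have r_ends: "r \<noteq> []" "hd r = hd p" using False by (auto simp: r_def)
      have "last r = last (rev q')"
        unfolding r_def by (subst (2) rq) (use lst False in simp)
      then have r_last: "last r = hd q'" using False by (simp add: last_rev)
      have "set (tl (rev q')) \<subseteq> set (rev q')" by (cases "rev q'") auto
      then have r_set: "set r \<subseteq> set p \<union> set q'" by (auto simp: r_def)
      from walk_to_path[OF r_walk r_ends(1)] r_ends r_last r_set
      obtain s where s: "s \<noteq> []" "hd s = hd p" "last s = hd q'" "set s \<subseteq> set p \<union> set q'"
        "distinct s" "successively (\<lambda>a b. {a, b} \<in> E) s"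
        by auto
      have "length s \<ge> 2" using s(1-3) ne by (cases s rule: remdups_adj.cases) auto
      then have "graph_cycle V E (v # s)"
        using s P Q False Cons.prems(1)
        by (auto simp: graph_cycle_def graph_path_def successively_Cons insert_commute)
      then show False using assms(1) by blast
    qed
    then show ?thesis using Cons.IH[OF P(4), of q'] Q False q' by auto
  qed
qed

text \<open>Statements about one fixed tree are collected in a locale. It is interpreted for the ambient
  tree and, when trees on a subset of the vertices are discussed, for those as well.\<close>

locale ftree =
  fixes V :: "'v set" and E :: "'v set set"
  assumes tree: "finite_tree V E"
begin

abbreviation "path \<equiv> tree_path V E"
abbreviation "step \<equiv> step_to V E"

text \<open>The vertices on the path from \<open>v\<close> to \<open>w\<close>. By \<open>seg_triangle\<close>, the
  avoidance of a fixed vertex by such segments is a transitive relation between their ends.\<close>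

definition seg :: "'v \<Rightarrow> 'v \<Rightarrow> 'v set" where "seg v w = set (path v w)"

lemma finite_V: "finite V" and edge_in: "{v, w} \<in> E \<Longrightarrow> v \<in> V \<and> w \<in> V \<and> v \<noteq> w"
  and edge_card: "e \<in> E \<Longrightarrow> e \<subseteq> V \<and> card e = 2"
proof -
  show "finite V" "e \<in> E \<Longrightarrow> e \<subseteq> V \<and> card e = 2" for e
    using tree by (auto simp: finite_tree_def)
  then show "v \<in> V \<and> w \<in> V \<and> v \<noteq> w" if "{v, w} \<in> E"
    using that by (force simp: card_2_iff doubleton_eq_iff)
qed

lemma tree_pathI: "graph_path V E v w p \<Longrightarrow> path v w = p"
  unfolding tree_path_def
proof (rule the_equality)
  have acyclic: "\<nexists>p. graph_cycle V E p" using tree unfolding finite_tree_def by blast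
  show "q = p" if "graph_path V E v w p" "graph_path V E v w q" for q
    using graph_path_unique[OF acyclic that(2,1)] .
qed

lemma tree_path: "v \<in> V \<Longrightarrow> w \<in> V \<Longrightarrow> graph_path V E v w (path v w)"
  using tree tree_pathI[of v w] unfolding finite_tree_def by metis

lemma seg_ends: "v \<in> V \<Longrightarrow> w \<in> V \<Longrightarrow> v \<in> seg v w \<and> w \<in> seg v w"
  using tree_path[of v w] by (metis graph_path_def hd_in_set last_in_set seg_def)

lemma seg_subset: "v \<in> V \<Longrightarrow> w \<in> V \<Longrightarrow> u \<in> seg v w \<Longrightarrow> u \<in> V"
  using tree_path[of v w] by (auto simp: graph_path_def seg_def)

lemma seg_commute: "v \<in> V \<Longrightarrow> w \<in> V \<Longrightarrow> seg v w = seg w v"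
  using tree_pathI[OF graph_path_rev[OF tree_path[of v w]]] by (simp add: seg_def)

lemma seg_self: "v \<in> V \<Longrightarrow> seg v v = {v}"
  using tree_pathI[of v v "[v]"] by (simp add: seg_def graph_path_def)

lemma seg_edge: "{v, w} \<in> E \<Longrightarrow> seg v w = {v, w}"
  using tree_pathI[of v w "[v, w]"] edge_in[of v w] by (simp add: seg_def graph_path_def)

lemma seg_split:
  assumes "v \<in> V" "w \<in> V" "u \<in> seg v w"
  shows "seg v w = seg v u \<union> seg u w" "seg v u \<inter> seg u w = {u}"
proof -
  note p = tree_path[OF assms(1,2)]
  obtain p1 p2 where e: "path v w = p1 @ u # p2"
    using assms(3) by (auto simp: seg_def in_set_conv_decomp)
  have "path v u = p1 @ [u]"
    by (rule tree_pathI) (use p in \<open>auto simp: e graph_path_def successively_append_iff hd_append\<close>)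
  moreover have "path u w = u # p2"
    by (rule tree_pathI) (use p in \<open>auto simp: e graph_path_def successively_append_iff hd_append\<close>)
  ultimately show "seg v w = seg v u \<union> seg u w" "seg v u \<inter> seg u w = {u}"
    using p by (auto simp: seg_def e graph_path_def)
qed

lemma seg_triangle:
  assumes "v \<in> V" "w \<in> V" "x \<in> V"
  shows "seg v w \<subseteq> seg v x \<union> seg x w"
proof -
  note p = tree_path[OF assms(1,3)] and q = tree_path[OF assms(3,2)]
  define r where "r = path v x @ tl (path x w)"
  have e: "path x w = x # tl (path x w)" using q by (metis graph_path_def list.collapse)
  have walk: "successively (\<lambda>a b. {a, b} \<in> E) r"
    using p q unfolding r_def graph_path_def
    by (subst (asm) (4) e) (auto simp: successively_append_iff successively_Cons)
  have ne: "r \<noteq> []" "hd r = v" using p by (auto simp: r_def graph_path_def)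
  have "last r = last (path x w)"
    unfolding r_def by (subst (2) e) (use p in \<open>simp add: graph_path_def\<close>)
  then have last: "last r = w" using q by (simp add: graph_path_def)
  have sub: "set r \<subseteq> seg v x \<union> seg x w"
    unfolding r_def seg_def using set_drop_subset[of 1 "path x w"] by (auto simp: drop_Suc)
  obtain s where s: "s \<noteq> []" "hd s = hd r" "last s = last r" "set s \<subseteq> set r"
        "distinct s" "successively (\<lambda>a b. {a, b} \<in> E) s"
    using walk_to_path[OF walk ne(1)] by blast
  have "set r \<subseteq> V" using sub seg_subset assms by blast
  then have "graph_path V E v w s"
    using s ne last by (simp add: graph_path_def)
  then show ?thesis using tree_pathI[of v w s] s(4) sub by (simp add: seg_def)
qed

lemma step_to:
  assumes "v \<in> V" "w \<in> V" "v \<noteq> w"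
  shows "{v, step v w} \<in> E" "step v w \<in> seg v w" "v \<notin> seg (step v w) w"
proof -
  note p = tree_path[OF assms(1,2)]
  obtain s r where e: "path v w = v # s # r"
    using p assms(3) by (cases "path v w" rule: remdups_adj.cases) (auto simp: graph_path_def)
  have "path s w = s # r"
    by (rule tree_pathI) (use p in \<open>auto simp: e graph_path_def\<close>)
  then show "{v, step v w} \<in> E" "step v w \<in> seg v w" "v \<notin> seg (step v w) w"
    using p e by (auto simp: seg_def step_to_def graph_path_def)
qed

lemma seg_avoid:
  "u \<notin> seg v x \<Longrightarrow> u \<notin> seg x w \<Longrightarrow> v \<in> V \<Longrightarrow> w \<in> V \<Longrightarrow> x \<in> V \<Longrightarrow> u \<notin> seg v w"
  using seg_triangle by blast

lemma seg_antisym: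
  assumes "v \<in> V" "w \<in> V" "u \<in> V" "u \<in> seg v w" "v \<in> seg u w"
  shows "u = v"
proof -
  have "v \<in> seg v u \<inter> seg u w" using seg_ends[of v u] assms by blast
  then show ?thesis using seg_split(2)[OF assms(1,2,4)] by simp
qed

lemma seg_between:
  assumes "v \<in> V" "w \<in> V" "u \<in> seg v w" "x \<in> seg u w"
  shows "x \<in> seg v w" "u \<in> seg v x"
proof -
  have V: "u \<in> V" "x \<in> V" using assms seg_subset by blast+
  show x: "x \<in> seg v w" using seg_split(1) assms by blast
  show "u \<in> seg v x"
    using seg_split(1)[OF assms(1,2) x] seg_antisym[of u w x] assms V seg_ends by blast
qed

lemma path_Cons:
  assumes "{v, x} \<in> E" "w \<in> V" "v \<notin> seg x w"
  shows "path v w = v # path x w"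
proof (rule tree_pathI)
  note V = edge_in[OF assms(1)]
  have "path x w \<noteq> []" "hd (path x w) = x"
    using tree_path[of x w] V assms by (auto simp: graph_path_def)
  then show "graph_path V E v w (v # path x w)"
    using tree_path[of x w] V assms by (auto simp: graph_path_def seg_def successively_Cons)
qed

lemma step_unique:
  assumes "{v, x} \<in> E" "w \<in> V" "v \<notin> seg x w"
  shows "step v w = x"
  using tree_path[of x w] edge_in[OF assms(1)] path_Cons[OF assms] assms(2)
  by (auto simp: step_to_def graph_path_def hd_conv_nth)

text \<open>Every vertex \<open>w\<close> lies on exactly one of the two sides of an edge \<open>{v, x}\<close>.\<close>

lemma edge_side:
  assumes "{v, x} \<in> E" "w \<in> V"
  shows "v \<notin> seg x w \<longleftrightarrow> x \<in> seg v w"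
proof
  note V = edge_in[OF assms(1)]
  show "x \<in> seg v w" if "v \<notin> seg x w"
    using path_Cons[OF assms that] seg_ends[of x w] V assms(2) by (simp add: seg_def)
  show "v \<notin> seg x w" if "x \<in> seg v w"
    using seg_split(2)[OF _ _ that] V assms(2) seg_ends by blast
qed

lemma seg_neighbours:
  assumes "{v, x} \<in> E" "{v, y} \<in> E" "x \<noteq> y"
  shows "v \<in> seg x y"
proof -
  have "graph_path V E x y [x, v, y]"
    using assms edge_in[of v x] edge_in[of v y] by (auto simp: graph_path_def insert_commute)
  from tree_pathI[OF this] show ?thesis by (simp add: seg_def)
qed

section \<open>Half-edges\<close>

text \<open>A variable \<open>x\<^bsub>e,y\<^esub>\<close> with \<open>e = {y, v}\<close> is regarded as the arrow \<open>y \<rightarrow> v\<close> along \<open>e\<close>, with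
  tail \<open>y\<close> and head \<open>v\<close>.\<close>

definition arrow :: "'v \<Rightarrow> 'v \<Rightarrow> 'v set \<times> 'v" where "arrow y v = ({y, v}, y)"

lemma arrow_eq [simp]: "arrow y v = arrow z w \<longleftrightarrow> y = z \<and> v = w"
  by (auto simp: arrow_def doubleton_eq_iff)

lemma incidence_arrow: "c \<in> incidence V E \<longleftrightarrow> (\<exists>y v. {y, v} \<in> E \<and> c = arrow y v)"
proof
  assume "c \<in> incidence V E"
  then obtain e y where c: "c = (e, y)" "e \<in> E" "y \<in> e" by (auto simp: incidence_def)
  then obtain v where "e = {y, v}" using edge_card[of e] by (auto simp: card_2_iff)
  with c show "\<exists>y v. {y, v} \<in> E \<and> c = arrow y v" by (auto simp: arrow_def)
qed (use edge_in in \<open>auto simp: incidence_def arrow_def\<close>)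

text \<open>The arrows \<open>y \<rightarrow> v\<close> and \<open>z \<rightarrow> w\<close> face each other if each one points to the side of its edge
  that contains the tail of the other one. The generators of the tree ideal are the products of
  two facing arrows, see \<open>facing_iff\<close>.\<close>

definition facing :: "'v \<Rightarrow> 'v \<Rightarrow> 'v \<Rightarrow> 'v \<Rightarrow> bool" where
  "facing y v z w \<longleftrightarrow> {y, v} \<in> E \<and> {z, w} \<in> E \<and> y \<notin> seg v z \<and> z \<notin> seg w y"

text \<open>The arrows \<open>y \<rightarrow> v\<close> and \<open>z \<rightarrow> w\<close> point away from each other if their reverses face each
  other. The differences \<open>h\<^bsub>v,w\<^esub>\<close> are the differences of two such arrows.\<close>

abbreviation outward :: "'v \<Rightarrow> 'v \<Rightarrow> 'v \<Rightarrow> 'v \<Rightarrow> bool" where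
  "outward y v z w \<equiv> facing v y w z"

lemma facing_commute: "facing y v z w \<longleftrightarrow> facing z w y v"
  by (auto simp: facing_def)

lemma facing_reverse: "{y, v} \<in> E \<Longrightarrow> facing y v v y"
  using edge_in[of y v] by (auto simp: facing_def seg_self insert_commute)

lemma facing_iff:
  "facing y v z w \<longleftrightarrow> y \<in> V \<and> z \<in> V \<and> y \<noteq> z \<and> v = step y z \<and> w = step z y"
proof
  assume f: "facing y v z w"
  then have E: "{y, v} \<in> E" "{z, w} \<in> E" by (auto simp: facing_def)
  note V = edge_in[OF E(1)] edge_in[OF E(2)]
  have "y \<noteq> z" using f V seg_ends by (auto simp: facing_def)
  then show "y \<in> V \<and> z \<in> V \<and> y \<noteq> z \<and> v = step y z \<and> w = step z y"
    using f V step_unique[OF E(1), of z] step_unique[OF E(2), of y] by (auto simp: facing_def)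
qed (use step_to in \<open>auto simp: facing_def\<close>)

text \<open>The sides that two outward arrows point to are disjoint.\<close>

lemma outward_disjoint:
  assumes "outward y v z w" "x \<in> V" "z \<notin> seg w x"
  shows "y \<in> seg v x"
proof (rule ccontr)
  assume y: "y \<notin> seg v x"
  have E: "{v, y} \<in> E" "{y, v} \<in> E" "{w, z} \<in> E" "{z, w} \<in> E" and vw: "v \<notin> seg y w" "w \<notin> seg z v"
    using assms(1) by (auto simp: facing_def insert_commute)
  note V = edge_in[OF E(1)] edge_in[OF E(3)] assms(2)
  have vx: "v \<in> seg y x" using edge_side[OF E(2), of x] V y by blast
  have wx: "w \<in> seg z x" using edge_side[OF E(4), of x] V assms(3) by blast
  have "y \<in> seg v w" using edge_side[OF E(1), of w] V vw by blast
  then have "y \<in> seg w x" using seg_triangle[of v w x] seg_commute V y by blast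
  then have "v \<in> seg w x" using seg_between(1)[of w x y v] vx V by blast
  moreover have "z \<in> seg w v" using edge_side[OF E(3), of v] V vw by blast
  then have "z \<in> seg v x" using seg_triangle[of w v x] seg_commute V assms(3) by blast
  then have "w \<in> seg v x" using seg_between(1)[of v x z w] wx V by blast
  ultimately have "v = w" using seg_antisym[of w x v] V by blast
  then show False using vw seg_ends[of y w] V by blast
qed

text \<open>This makes a difference of outward arrows a nonzerodivisor: in the graph of facing arrows,
  each neighbour of one is adjacent to each neighbour of the other.\<close>

lemma outward_neighbours_facing:
  assumes "outward y v z w" "facing y v y1 v1" "facing z w z1 w1"
  shows "facing y1 v1 z1 w1"
proof -
  have *: "y1 \<notin> seg v1 z1"
    if "outward y v z w" "facing y v y1 v1" "facing z w z1 w1" for y v z w y1 v1 z1 w1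
  proof
    assume y1: "y1 \<in> seg v1 z1"
    have E: "{y, v} \<in> E" "{y1, v1} \<in> E" "{z1, w1} \<in> E"
      and n: "y \<notin> seg v y1" "y1 \<notin> seg v1 y" "z \<notin> seg w z1"
      using that by (auto simp: facing_def)
    note V = edge_in[OF E(1)] edge_in[OF E(2)] edge_in[OF E(3)]
    have "y \<in> seg v z1" using outward_disjoint[OF that(1)] V n(3) by blast
    moreover have "y1 \<in> seg y z1" using seg_triangle[of v1 z1 y] V y1 n(2) by blast
    ultimately have "y \<in> seg v y1" using seg_between(2)[of v z1 y y1] V by blast
    then show False using n(1) by blast
  qed
  have "outward z w y v" using assms(1) facing_commute by blast
  then show ?thesis
    using *[OF assms] *[OF _ assms(3,2)] assms(2,3) unfolding facing_def by blast
qed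

text \<open>A converse, modulo a symmetric and transitive relation \<open>R\<close> such that distinct related arrows
  are outward and facing arrows are not related: if in the quotient graph every neighbour of one arrow
  is adjacent to every neighbour of another one, then the two arrows are outward.\<close>

lemma outward_if_neighbours_facing:
  fixes R :: "('v set \<times> 'v) \<Rightarrow> ('v set \<times> 'v) \<Rightarrow> bool"
  assumes R: "symp R" "transp R"
    and noloop: "\<And>y v z w. R (arrow y v) (arrow z w) \<Longrightarrow> \<not> facing y v z w"
    and out: "\<And>y v z w. R (arrow y v) (arrow z w) \<Longrightarrow> arrow y v = arrow z w \<or> outward y v z w"
    and E: "{y, v} \<in> E" "{z, w} \<in> E"
    and adj: "\<And>y1 v1 z1 w1. facing y v y1 v1 \<Longrightarrow> facing z w z1 w1 \<Longrightarrow>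
      \<exists>p p' x x'. facing p p' x x' \<and> R (arrow p p') (arrow y1 v1) \<and> R (arrow x x') (arrow z1 w1)"
  shows "outward y v z w"
proof -
  have *: "v \<notin> seg y w"
    if E: "{y, v} \<in> E" "{z, w} \<in> E"
    and adj: "\<And>y1 v1 z1 w1. facing y v y1 v1 \<Longrightarrow> facing z w z1 w1 \<Longrightarrow>
      \<exists>p p' x x'. facing p p' x x' \<and> R (arrow p p') (arrow y1 v1) \<and> R (arrow x x') (arrow z1 w1)"
    for y v z w
  proof
    assume vw: "v \<in> seg y w"
    have E': "{v, y} \<in> E" "{w, z} \<in> E" using E by (auto simp: insert_commute)
    note V = edge_in[OF E(1)] edge_in[OF E(2)]
    have y: "y \<notin> seg v w" using edge_side[OF E(1), of w] V vw by blast
    show False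
    proof (cases "w \<in> seg z v")
      case False
      then have "z \<in> seg w v" using edge_side[OF E'(2), of v] V by blast
      then have "z \<in> seg y w" using seg_between(1)[of y w v z] seg_commute V vw by blast
      then have "w \<notin> seg z y"
        using seg_antisym[of z y w] seg_commute V by blast
      then have "facing y v w z" using E E' y by (auto simp: facing_def)
      \<comment> \<open>The arrows have the same direction, and \<open>w \<rightarrow> z\<close> is a common neighbour. It would have to be
        adjacent to itself in the quotient graph.\<close>
      from adj[OF this facing_reverse[OF E(2)]]
      show False using noloop R by (meson sympE transpE)
    next
      case True
      then have z: "z \<notin> seg w v" using edge_side[OF E(2), of v] V by blast
      then have "z \<noteq> v" using seg_ends[of w v] V by blast
      \<comment> \<open>The arrows face each other. Their neighbours \<open>v \<rightarrow> y\<close> and \<open>v \<rightarrow> s\<close> have the common tail \<open>v\<close>,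
        so that everything equivalent to one of them points away from \<open>v\<close>; but two arrows that
        point away from \<open>v\<close> do not face each other.\<close>
      define s where "s = step v z"
      have s: "{v, s} \<in> E" "v \<notin> seg s z"
        using step_to[of v z] V \<open>z \<noteq> v\<close> by (auto simp: s_def)
      then have "facing z w v s" using E z by (auto simp: facing_def)
      from adj[OF facing_reverse[OF E(1)] this]
      obtain p p' x x' where pp: "facing p p' x x'" "R (arrow p p') (arrow v y)" "R (arrow x x') (arrow v s)"
        by blast
      have away: "q \<in> seg v q'" if "R (arrow q q') (arrow v r)" "{q, q'} \<in> E" "{v, r} \<in> E" for q q' r
      proof (rule ccontr)
        assume q: "q \<notin> seg v q'"
        note V' = edge_in[OF that(2)] edge_in[OF that(3)]
        have n: "\<not> facing q q' v r" "q = v \<and> q' = r \<or> outward q q' v r"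
          using that noloop out by (force, force)
        have "q \<noteq> v" using q seg_ends[of v q'] V' by blast
        then have o: "outward q q' v r" using n by blast
        then have q': "q' \<notin> seg q r" "r \<notin> seg v q'" by (auto simp: facing_def)
        have "{q', q} \<in> E" using that(2) by (simp add: insert_commute)
        then have "q' \<in> seg q v" using edge_side[of q' q v] q seg_commute V' by blast
        then have "q' \<in> seg r v" using seg_triangle[of q v r] V' q' by blast
        then have "q' = r \<or> q' = v" using seg_edge[OF that(3)] seg_commute[of r v] V' by auto
        moreover have "q' \<noteq> r" using q'(2) seg_ends V' by blast
        ultimately have "q' = v" by blast
        then have "q = r" using seg_neighbours[of v q r] q'(1) that by (auto simp: insert_commute)
        then have "facing q q' v r" using \<open>q' = v\<close> facing_reverse that(2) by blast
        then show False using n by blast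
      qed
      have Ep: "{p, p'} \<in> E" "{x, x'} \<in> E" and n: "p \<notin> seg p' x" "x \<notin> seg x' p"
        using pp(1) by (auto simp: facing_def)
      note V' = edge_in[OF Ep(1)] edge_in[OF Ep(2)]
      have "p \<in> seg v p'" "x \<in> seg v x'" using away pp Ep E' s by blast+
      then have "p \<in> seg v x" "x \<in> seg v p"
        using seg_triangle[of v p' x] seg_triangle[of v x' p] seg_commute V V' n by blast+
      then have "p = x" using seg_antisym[of p v x] seg_commute V V' by blast
      then show False using n seg_ends V' by blast
    qed
  qed
  have "v \<notin> seg y w" by (rule *[OF E adj])
  moreover have "w \<notin> seg z v"
    by (rule *[OF E(2,1)]) (use adj facing_commute in blast)
  ultimately show ?thesis using E by (auto simp: facing_def insert_commute)
qed

end

section \<open>Trees flowing with a given tree\<close>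

lemma finite_tree_singleton: "finite_tree {x} {}"
proof -
  have "graph_path {x} {} x x [x]" by (simp add: graph_path_def)
  moreover have False if "graph_cycle {x} {} p" for p :: "'a list"
    using that by (cases p rule: remdups_adj.cases) (auto simp: graph_cycle_def)
  ultimately show ?thesis unfolding finite_tree_def by auto
qed

lemma finite_tree_insert:
  assumes tree: "finite_tree U S" and u: "u \<in> U" and x: "x \<notin> U"
  shows "finite_tree (insert x U) (insert {u, x} S)"
proof -
  let ?U = "insert x U" and ?S = "insert {u, x} S"
  have S: "S \<subseteq> {e. e \<subseteq> U \<and> card e = 2}" and acyclic: "\<nexists>p. graph_cycle U S p"
    and paths: "\<And>v w. v \<in> U \<Longrightarrow> w \<in> U \<Longrightarrow> \<exists>p. graph_path U S v w p"
    using tree unfolding finite_tree_def by blast+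
  have mono: "graph_path ?U ?S v w p" if "graph_path U S v w p" for v w p
    using that unfolding graph_path_def by (auto elim: successively_mono)
  have from_x: "\<exists>p. graph_path ?U ?S x w p" if "w \<in> U" for w
  proof -
    obtain p where p: "graph_path U S u w p" using paths[OF u \<open>w \<in> U\<close>] by blast
    then have "graph_path ?U ?S x w (x # p)"
      using mono[OF p] x by (auto simp: graph_path_def successively_Cons insert_commute)
    then show ?thesis ..
  qed
  have "\<exists>p. graph_path ?U ?S v w p" if "v \<in> ?U" "w \<in> ?U" for v w
  proof -
    have "graph_path ?U ?S x x [x]" by (simp add: graph_path_def)
    moreover have "\<exists>p. graph_path ?U ?S w x p" if "w \<in> U" for w
      using from_x[OF that] graph_path_rev by fast
    moreover have "\<exists>p. graph_path ?U ?S v w p" if "v \<in> U" "w \<in> U" for v w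
      using paths[OF that] mono by fast
    ultimately show ?thesis using that from_x by auto
  qed
  moreover have False if "graph_cycle ?U ?S p" for p
  proof -
    have p: "3 \<le> length p" "set p \<subseteq> ?U" "distinct p" "successively (\<lambda>a b. {a, b} \<in> ?S) p"
      "{last p, hd p} \<in> ?S"
      using that by (auto simp: graph_cycle_def)
    have nbr: "b = u" if "{x, b} \<in> ?S" for b
      using that S x by (auto simp: doubleton_eq_iff)
    show False
    proof (cases "x \<in> set p")
      case False
      have "p \<noteq> []" using p(1) by auto
      then have "last p \<noteq> x" "hd p \<noteq> x" using False by auto
      moreover have "successively (\<lambda>a b. {a, b} \<in> S) p"
        by (rule successively_mono[OF p(4)]) (use False in \<open>auto simp: doubleton_eq_iff\<close>)
      ultimately have "graph_cycle U S p"
        using p False by (auto simp: graph_cycle_def doubleton_eq_iff)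
      then show False using acyclic by blast
    next
      case True
      then obtain p1 p2 where e: "p = p1 @ x # p2" by (auto simp: in_set_conv_decomp)
      consider "p1 \<noteq> []" "p2 \<noteq> []" | "p1 = []" "p2 \<noteq> []" | "p1 \<noteq> []" "p2 = []"
        using p(1) e by fastforce
      then show False
      proof cases
        case 1
        then have "{x, last p1} \<in> ?S" "{x, hd p2} \<in> ?S"
          using p(4) e by (auto simp: successively_append_iff successively_Cons insert_commute)
        then have "last p1 = hd p2" using nbr by metis
        then show False using 1 p(3) e by (auto simp: disjoint_iff) (metis hd_in_set last_in_set)
      next
        case 2
        then have "{x, hd p2} \<in> ?S" "{x, last p2} \<in> ?S"
          using p(4,5) e by (auto simp: successively_Cons insert_commute)
        then have "hd p2 = last p2" using nbr by metis
        then show False using 2 p e by (cases p2) (auto split: if_splits)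
      next
        case 3
        then have "{x, hd p1} \<in> ?S" "{x, last p1} \<in> ?S"
          using p(4,5) e by (auto simp: successively_append_iff insert_commute)
        then have "hd p1 = last p1" using nbr by metis
        then show False using 3 p e by (cases p1) (auto split: if_splits)
      qed
    qed
  qed
  ultimately show ?thesis
    using tree S u x unfolding finite_tree_def by (auto simp: card_insert_if)
qed

context ftree
begin

lemma aligned_seg: "aligned V E v u w \<longleftrightarrow> u \<in> seg v w"
  by (simp add: aligned_def seg_def)

text \<open>A tree on \<open>U\<close> all of whose edges join vertices with no further element of \<open>U\<close> between them
  flows with the ambient tree.\<close>

lemma closest_tree_flows:
  assumes "U \<subseteq> V" "finite_tree U S" "\<And>v w. {v, w} \<in> S \<Longrightarrow> seg v w \<inter> U = {v, w}"
  shows "flows_with V E U S"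
proof -
  interpret S: ftree U S by unfold_locales fact
  have avoid: "u \<notin> seg (hd p) (last p)"
    \<comment> \<open>the segments of the edges avoid \<open>u\<close>, and avoidance is transitive\<close>
    if "p \<noteq> []" "set p \<subseteq> U" "successively (\<lambda>a b. {a, b} \<in> S) p" "u \<in> U" "u \<notin> set p" for u p
    using that
  proof (induction p)
    case (Cons a p)
    show ?case
    proof (cases "p = []")
      case True
      then show ?thesis using Cons.prems assms(1) seg_self by auto
    next
      case False
      then have "{a, hd p} \<in> S" "u \<notin> {a, hd p}"
        using Cons.prems by (auto simp: successively_Cons)
      then have "u \<notin> seg a (hd p)" using assms(3) Cons.prems(4) by blast
      moreover have "u \<notin> seg (hd p) (last p)"
        using Cons False by (auto simp: successively_Cons)
      moreover have "set p \<subseteq> V" "a \<in> V" using Cons.prems(2) assms(1) by auto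
      then have "hd p \<in> V" "last p \<in> V" "a \<in> V"
        using hd_in_set[OF False] last_in_set[OF False] by blast+
      ultimately show ?thesis using False seg_avoid[of u a "hd p" "last p"] by auto
    qed
  qed simp
  show ?thesis
    unfolding flows_with_def
  proof (intro ballI impI)
    fix v u w assume U: "v \<in> U" "u \<in> U" "w \<in> U" "aligned V E v u w"
    have "graph_path U S v w (tree_path U S v w)" using S.tree_path U by blast
    then have "u \<in> set (tree_path U S v w)"
      using avoid[of "tree_path U S v w" u] U(2) U(4)[unfolded aligned_seg]
      by (auto simp: graph_path_def)
    then show "aligned U S v u w" by (simp add: aligned_def)
  qed
qed

lemma card_seg_less:
  assumes "v \<in> V" "w \<in> V" "u \<in> seg v w"
  shows "u \<noteq> w \<Longrightarrow> card (seg v u) < card (seg v w)" "u \<noteq> v \<Longrightarrow> card (seg u w) < card (seg v w)"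
proof -
  have u: "u \<in> V" using assms seg_subset by blast
  have "finite (seg v w)" by (simp add: seg_def)
  moreover have "w \<notin> seg v u" if "u \<noteq> w"
    using seg_split(2)[OF assms] seg_ends[of u w] u assms that by (metis IntI singletonD)
  moreover have "v \<notin> seg u w" if "u \<noteq> v"
    using seg_split(2)[OF assms] seg_ends[of v u] u assms that by (metis IntI singletonD)
  ultimately show "u \<noteq> w \<Longrightarrow> card (seg v u) < card (seg v w)" "u \<noteq> v \<Longrightarrow> card (seg u w) < card (seg v w)"
    using seg_split(1)[OF assms] seg_ends[OF assms(1,2)] by (metis psubset_card_mono psubsetI Un_upper1, metis psubset_card_mono psubsetI Un_upper2)
qed

text \<open>Such a tree is grown vertex by vertex: a maximal partial tree on \<open>W \<subseteq> U\<close> is enlarged by an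
  edge that joins a closest pair of vertices of \<open>W\<close> and \<open>U - W\<close>.\<close>

lemma closest_tree_exists:
  assumes "U \<subseteq> V" "U \<noteq> {}"
  shows "\<exists>S. finite_tree U S \<and> (\<forall>v w. {v, w} \<in> S \<longrightarrow> seg v w \<inter> U = {v, w})"
proof -
  define P where "P W \<longleftrightarrow> W \<subseteq> U \<and> W \<noteq> {} \<and>
    (\<exists>S. finite_tree W S \<and> (\<forall>v w. {v, w} \<in> S \<longrightarrow> seg v w \<inter> U = {v, w}))" for W
  have finU: "finite U" using assms finite_V finite_subset by blast
  obtain x where "x \<in> U" using assms by blast
  then have "P {x}" using finite_tree_singleton[of x] by (auto simp: P_def)
  moreover have "finite {W. P W}"
    by (rule finite_subset[of _ "Pow U"]) (use finU in \<open>auto simp: P_def\<close>)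
  ultimately obtain W where W: "P W" and max: "\<And>W'. P W' \<Longrightarrow> W \<subseteq> W' \<Longrightarrow> W = W'"
    using finite_has_maximal2[of "{W. P W}" "{x}"] by auto
  have "W = U"
  proof (rule ccontr)
    assume "W \<noteq> U"
    with W obtain v0 w0 where "v0 \<in> W" "w0 \<in> U - W" by (auto simp: P_def)
    then obtain vw where vw: "fst vw \<in> W \<and> snd vw \<in> U - W"
      and least: "\<And>vw'. fst vw' \<in> W \<and> snd vw' \<in> U - W \<Longrightarrow>
        card (seg (fst vw) (snd vw)) \<le> card (seg (fst vw') (snd vw'))"
      using ex_has_least_nat[of "\<lambda>vw. fst vw \<in> W \<and> snd vw \<in> U - W" "(v0, w0)"
          "\<lambda>vw. card (seg (fst vw) (snd vw))"] by auto
    define v w where "v = fst vw" and "w = snd vw"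
    have v: "v \<in> W" "v \<in> U" "v \<in> V" and w: "w \<in> U" "w \<notin> W" "w \<in> V"
      using vw W assms by (auto simp: P_def v_def w_def)
    have vw_seg: "seg v w \<inter> U = {v, w}"
    proof -
      have "u = v \<or> u = w" if u: "u \<in> seg v w" "u \<in> U" for u
      proof (rule ccontr)
        assume "\<not> ?thesis"
        then have "card (seg v u) < card (seg v w)" "card (seg u w) < card (seg v w)"
          using card_seg_less[of v w u] u v w by auto
        then show False
          using least[of "(v, u)"] least[of "(u, w)"] u v w by (cases "u \<in> W") (auto simp: v_def w_def)
      qed
      then show ?thesis using seg_ends v w by blast
    qed
    obtain S where S: "finite_tree W S" "\<forall>v w. {v, w} \<in> S \<longrightarrow> seg v w \<inter> U = {v, w}"
      using W by (auto simp: P_def)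
    have "finite_tree (insert w W) (insert {v, w} S)"
      using finite_tree_insert[OF S(1) v(1) w(2)] .
    moreover have "seg v' w' \<inter> U = {v', w'}" if "{v', w'} \<in> insert {v, w} S" for v' w'
    proof (cases "{v', w'} \<in> S")
      case True
      then show ?thesis using S(2) by blast
    next
      case False
      then have "v' = v \<and> w' = w \<or> v' = w \<and> w' = v" using that by (simp add: doubleton_eq_iff)
      then show ?thesis using vw_seg seg_commute[OF v(3) w(3)] by (metis insert_commute)
    qed
    moreover have "insert w W \<subseteq> U" "insert w W \<noteq> {}" using W w(1) by (auto simp: P_def)
    ultimately have "P (insert w W)" unfolding P_def by (intro conjI exI[of _ "insert {v, w} S"]) auto
    then show False using max[of "insert w W"] w by auto
  qed
  then show ?thesis using W by (auto simp: P_def)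
qed

section \<open>The identifications prescribed by a set of vertices\<close>

text \<open>For independent \<open>U\<close>, the arrows identified by \<open>L(U)\<close> are those with head in \<open>U\<close> whose tails
  lie in the same component of the forest obtained by deleting \<open>U\<close>. In this form transitivity is
  immediate. The relation is reflexive on the arrows with head in \<open>U\<close> because their tails are not
  in \<open>U\<close>, by independence.\<close>

definition block_rel :: "'v set \<Rightarrow> 'v set \<times> 'v \<Rightarrow> 'v set \<times> 'v \<Rightarrow> bool" where
  "block_rel U a b \<longleftrightarrow> (\<exists>y v z w. a = arrow y v \<and> b = arrow z w \<and> {y, v} \<in> E \<and> {z, w} \<in> E \<and>
     v \<in> U \<and> w \<in> U \<and> seg y z \<inter> U = {})"

lemma block_rel_arrow: "block_rel U (arrow y v) (arrow z w) \<longleftrightarrow>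
    {y, v} \<in> E \<and> {z, w} \<in> E \<and> v \<in> U \<and> w \<in> U \<and> seg y z \<inter> U = {}"
  by (auto simp: block_rel_def)

lemma block_rel_sym: "block_rel U a b \<Longrightarrow> block_rel U b a"
  using seg_commute edge_in unfolding block_rel_def by metis

lemma block_rel_trans: "block_rel U a b \<Longrightarrow> block_rel U b c \<Longrightarrow> block_rel U a c"
proof -
  assume "block_rel U a b" "block_rel U b c"
  then obtain y v z w x u where abc: "a = arrow y v" "b = arrow z w" "c = arrow x u"
    and E: "{y, v} \<in> E" "{z, w} \<in> E" "{x, u} \<in> E" and U: "v \<in> U" "u \<in> U"
    and "seg y z \<inter> U = {}" "seg z x \<inter> U = {}"
    unfolding block_rel_def by auto
  moreover have "seg y x \<subseteq> seg y z \<union> seg z x" using seg_triangle edge_in E by blast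
  ultimately have "seg y x \<inter> U = {}" by blast
  then show "block_rel U a c" using abc E U by (simp add: block_rel_arrow)
qed

lemma block_rel_outward:
  assumes "block_rel U (arrow y v) (arrow z w)"
  shows "\<not> facing y v z w" "arrow y v = arrow z w \<or> outward y v z w"
proof -
  have E: "{y, v} \<in> E" "{z, w} \<in> E" "{v, y} \<in> E" "{w, z} \<in> E" and U: "v \<in> U" "w \<in> U" "seg y z \<inter> U = {}"
    using assms by (auto simp: block_rel_arrow insert_commute)
  note V = edge_in[OF E(1)] edge_in[OF E(2)]
  show "\<not> facing y v z w" using edge_side[OF E(1), of z] V U by (auto simp: facing_def)
  show "arrow y v = arrow z w \<or> outward y v z w"
  proof (cases "v = w")
    case True
    then have "y = z" using seg_neighbours[OF E(3), of z] E U by auto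
    then show ?thesis using True by simp
  next
    case False
    have "seg y z \<inter> {v, w} = {}" "y \<in> seg y z" "z \<in> seg y z" using U seg_ends V by blast+
    moreover have "seg y w \<subseteq> seg y z \<union> {z, w}" "seg z v \<subseteq> seg y z \<union> {y, v}"
      using seg_triangle[of y w z] seg_triangle[of z v y] seg_edge E(1,2) seg_commute[of z y] V by auto
    ultimately have "v \<notin> seg y w" "w \<notin> seg z v" using False by auto
    then show ?thesis using E by (simp add: facing_def)
  qed
qed

lemma block_rel_step:
  assumes "block_rel U (arrow y v) (arrow z w)" "v \<noteq> w"
  shows "y = step v w" "z = step w v"
  using block_rel_outward(2)[OF assms(1)] assms(2) by (auto simp: facing_iff)

lemma block_rel_closest:
  assumes "U \<subseteq> V" "independent_set E U" "v \<noteq> w" "seg v w \<inter> U = {v, w}"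
  shows "block_rel U (arrow (step v w) v) (arrow (step w v) w)"
proof -
  have V: "v \<in> U" "w \<in> U" "v \<in> V" "w \<in> V" using assms by auto
  define y z where "y = step v w" and "z = step w v"
  have y: "{v, y} \<in> E" "y \<in> seg v w" "v \<notin> seg y w"
    using step_to[of v w] assms V by (auto simp: y_def)
  have z: "{w, z} \<in> E" "z \<in> seg v w" "w \<notin> seg z v"
    using step_to[of w v] seg_commute[of v w] assms V by (auto simp: z_def)
  note V = V edge_in[OF y(1)] edge_in[OF z(1)]
  have indep: "{v, w} \<notin> E" using assms V by (auto simp: independent_set_def)
  have sub: "seg y w \<subseteq> seg v w" "seg v z \<subseteq> seg v w"
    using seg_split(1)[of v w] y z V by blast+
  have "seg y z \<subseteq> seg y w \<union> {w, z}" "seg y z \<subseteq> {v, y} \<union> seg v z"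
    using seg_triangle[of y z w] seg_triangle[of y z v] seg_edge[OF z(1)] seg_edge[OF y(1)]
      seg_commute[of y v] V by auto
  then have "seg y z \<subseteq> seg v w" "v \<notin> seg y z" "w \<notin> seg y z"
    using sub y z V seg_commute[of z v] indep assms(3) by (blast, auto simp: insert_commute)
  moreover have "x = v \<or> x = w" if "x \<in> seg v w" "x \<in> U" for x using assms(4) that by auto
  ultimately have "seg y z \<inter> U = {}" by blast
  then show ?thesis using V y z by (simp add: block_rel_arrow y_def z_def insert_commute)
qed

lemma tree_difference_arrow:
  "tree_difference V E v w = pvar (arrow (step v w) v) - pvar (arrow (step w v) w)"
  by (simp add: tree_difference_def arrow_def Let_def insert_commute)

lemma tree_monomial_arrow:
  "tree_monomial V E v w = pvar (arrow v (step v w)) * pvar (arrow w (step w v))"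
  by (simp add: tree_monomial_def arrow_def Let_def)

lemma flowing_tree_closest:
  assumes "U \<subseteq> V" "finite_tree U S" "flows_with V E U S" "{v, w} \<in> S"
  shows "v \<noteq> w" "seg v w \<inter> U = {v, w}"
proof -
  interpret S: ftree U S by unfold_locales fact
  note U = S.edge_in[OF assms(4)]
  show "v \<noteq> w" using U by blast
  have "u \<in> {v, w}" if "u \<in> seg v w" "u \<in> U" for u
  proof -
    have "aligned U S v u w"
      using assms(3) that U by (auto simp: flows_with_def aligned_seg)
    then show ?thesis using S.seg_edge[OF assms(4)] by (simp add: S.aligned_seg)
  qed
  then show "seg v w \<inter> U = {v, w}" using seg_ends[of v w] U assms(1) by blast
qed

text \<open>The space of every flowing tree on an independent set \<open>U\<close> is spanned by the differences of
  equivalent arrows, hence does not depend on the tree. Given two equivalent arrows with heads \<open>v\<close>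
  and \<open>w\<close>, the difference is a telescoping sum along the path from \<open>v\<close> to \<open>w\<close> in \<open>S\<close>.\<close>

lemma L_tree_eq:
  assumes U: "U \<subseteq> V" "independent_set E U" and S: "finite_tree U S" "flows_with V E U S"
  shows "(L_tree V E S :: ('v set \<times> 'v, 'k::field) mpoly set) =
    lin.span {pvar a - pvar b | a b. block_rel U a b}" (is "_ = lin.span ?D")
proof (rule antisym)
  show "L_tree V E S \<subseteq> lin.span ?D"
    unfolding L_tree_def
  proof (rule lin.span_mono, safe)
    fix v w assume "{v, w} \<in> S"
    from flowing_tree_closest[OF U(1) S this]
    show "\<exists>a b. (tree_difference V E v w :: ('v set \<times> 'v, 'k) mpoly) = pvar a - pvar b \<and> block_rel U a b"
      using block_rel_closest[OF U] tree_difference_arrow by blast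
  qed
next
  interpret S: ftree U S by unfold_locales fact
  let ?L = "L_tree V E S :: ('v set \<times> 'v, 'k) mpoly set"
  have *: "pvar (arrow y v) - pvar (arrow z w) \<in> ?L"
    if "graph_path U S v w p" "block_rel U (arrow y v) (arrow z w)" for p y v z w
    using that
  proof (induction p arbitrary: y v)
    case Nil
    then show ?case by (simp add: graph_path_def)
  next
    case (Cons a p)
    show ?case
    proof (cases "v = w")
      case True
      then have "arrow y v = arrow z w"
        using block_rel_outward(2)[OF Cons.prems(2)] block_rel_arrow Cons.prems(2)
          edge_in by (auto simp: facing_iff)
      then show ?thesis by (simp add: L_tree_def lin.span_zero)
    next
      case False
      then have "p \<noteq> []" using Cons.prems(1) by (auto simp: graph_path_def)
      note P = graph_path_ConsD[OF Cons.prems(1) this]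
      define v1 where "v1 = hd p"
      note P = P[folded v1_def]
      define y1 z1 where "y1 = step v v1" and "z1 = step v1 v"
      have vv1: "v \<noteq> v1" "seg v v1 \<inter> U = {v, v1}" using flowing_tree_closest[OF U(1) S P(2)] .
      then have r: "block_rel U (arrow y1 v) (arrow z1 v1)"
        using block_rel_closest[OF U] by (simp add: y1_def z1_def)
      have E: "{y1, v} \<in> E" "{z1, v1} \<in> E" "{y, v} \<in> E" "{z, w} \<in> E" and Uv: "v \<in> U" "v1 \<in> U" "w \<in> U"
        using r Cons.prems(2) by (auto simp: block_rel_arrow)
      note V = edge_in[OF E(1)] edge_in[OF E(2)] edge_in[OF E(3)] edge_in[OF E(4)]
      have "tree_path U S v1 w = p" using S.tree_pathI[OF P(4)] .
      then have "v \<notin> seg v1 w"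
        using S(2) Uv P(3) by (auto simp: flows_with_def aligned_seg S.aligned_seg S.seg_def)
      moreover have "v \<notin> seg y1 v1" "v \<notin> seg w y"
        using step_to(3)[of v v1] step_to(3)[of v w] vv1 False V block_rel_step(1)[OF Cons.prems(2)]
         seg_commute[of w y]
        by (auto simp: y1_def)
      ultimately have "v \<notin> seg y1 y"
        using seg_avoid[of v y1 v1 w] seg_avoid[of v y1 w y] V by blast
      \<comment> \<open>otherwise \<open>v\<close> would lie between \<open>v1\<close> and \<open>w\<close>, hence on their path in \<open>S\<close>\<close>
      then have "y1 = y" using seg_neighbours[of v y1 y] E by (auto simp: insert_commute)
      with r have "block_rel U (arrow z1 v1) (arrow z w)"
        using Cons.prems(2) block_rel_sym block_rel_trans by blast
      from Cons.IH[OF P(4) this] have "pvar (arrow z1 v1) - pvar (arrow z w) \<in> ?L" .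
      moreover have "(tree_difference V E v v1 :: ('v set \<times> 'v, 'k) mpoly) =
          pvar (arrow y v) - pvar (arrow z1 v1)"
        using \<open>y1 = y\<close> tree_difference_arrow[of v v1, folded y1_def z1_def] by simp
      then have "pvar (arrow y v) - pvar (arrow z1 v1) \<in> ?L"
        unfolding L_tree_def
        by (intro lin.span_base CollectI exI[of _ v] exI[of _ v1]) (use P(2) in simp)
      ultimately have "(pvar (arrow y v) - pvar (arrow z1 v1)) + (pvar (arrow z1 v1) - pvar (arrow z w)) \<in> ?L"
        unfolding L_tree_def by (intro lin.span_add)
      then show ?thesis by simp
    qed
  qed
  have "?D \<subseteq> ?L"
  proof safe
    fix a b assume r: "block_rel U a b"
    then obtain y v z w where ab: "a = arrow y v" "b = arrow z w" and "v \<in> U" "w \<in> U"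
      by (auto simp: block_rel_def)
    then show "pvar a - pvar b \<in> ?L" using *[OF S.tree_path] r by blast
  qed
  then show "lin.span ?D \<subseteq> ?L"
    by (simp add: L_tree_def lin.span_minimal)
qed

lemma L_set_eq:
  assumes U: "U \<subseteq> V" "U \<noteq> {}" "independent_set E U"
  shows "(L_set V E U :: ('v set \<times> 'v, 'k::field) mpoly set) =
    lin.span {pvar a - pvar b | a b. block_rel U a b}"
  unfolding L_set_def
proof (rule the_equality)
  obtain S where "finite_tree U S" "flows_with V E U S"
    using closest_tree_exists[OF U(1,2)] closest_tree_flows[OF U(1)] by blast
  then show "\<exists>S. finite_tree U S \<and> flows_with V E U S \<and>
      lin.span {pvar a - pvar b | a b. block_rel U a b} = (L_tree V E S :: ('v set \<times> 'v, 'k) mpoly set)"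
    using L_tree_eq[OF U(1,3)] by blast
qed (use L_tree_eq[OF U(1,3)] in blast)

end

section \<open>Substituting variables\<close>

text \<open>The substitution \<open>x\<^sub>c \<mapsto> x\<^bsub>q c\<^esub>\<close>, first on monomials (exponent functions) and then on
  polynomials.\<close>

definition mon_subst :: "('x \<Rightarrow> 'x) \<Rightarrow> ('x \<Rightarrow>\<^sub>0 nat) \<Rightarrow> ('x \<Rightarrow>\<^sub>0 nat)" where
  "mon_subst q m = (\<Sum>c\<in>Poly_Mapping.keys m. Poly_Mapping.single (q c) (Poly_Mapping.lookup m c))"

definition var_subst :: "('x \<Rightarrow> 'x) \<Rightarrow> ('x, 'k::field) mpoly \<Rightarrow> ('x, 'k) mpoly" where
  "var_subst q f =
     (\<Sum>m\<in>Poly_Mapping.keys f. Poly_Mapping.single (mon_subst q m) (Poly_Mapping.lookup f m))"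

lemma poly_mapping_expand:
  "(\<Sum>m\<in>Poly_Mapping.keys f. Poly_Mapping.single m (Poly_Mapping.lookup f m)) = f"
  by (rule poly_mapping_eqI)
     (auto simp: lookup_sum lookup_single when_def in_keys_iff)

lemma mon_subst_superset:
  assumes "finite A" "Poly_Mapping.keys m \<subseteq> A"
  shows "mon_subst q m = (\<Sum>c\<in>A. Poly_Mapping.single (q c) (Poly_Mapping.lookup m c))"
  unfolding mon_subst_def using assms by (intro sum.mono_neutral_left) (auto simp: in_keys_iff)

lemma var_subst_superset:
  assumes "finite A" "Poly_Mapping.keys f \<subseteq> A"
  shows "var_subst q f = (\<Sum>m\<in>A. Poly_Mapping.single (mon_subst q m) (Poly_Mapping.lookup f m))"
  unfolding var_subst_def using assms by (intro sum.mono_neutral_left) (auto simp: in_keys_iff)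

lemma mon_subst_zero [simp]: "mon_subst q 0 = 0"
  by (simp add: mon_subst_def)

lemma mon_subst_single [simp]: "mon_subst q (Poly_Mapping.single c n) = Poly_Mapping.single (q c) n"
  by (simp add: mon_subst_def)

lemma mon_subst_add: "mon_subst q (m + n) = mon_subst q m + mon_subst q n"
proof -
  let ?A = "Poly_Mapping.keys m \<union> Poly_Mapping.keys n"
  have "Poly_Mapping.keys (m + n) \<subseteq> ?A" by (rule Poly_Mapping.keys_add)
  then show ?thesis
    by (simp add: mon_subst_superset[of ?A] lookup_add single_add sum.distrib)
qed

lemma keys_mon_subst: "Poly_Mapping.keys (mon_subst q m) \<subseteq> q ` Poly_Mapping.keys m"
  using keys_sum[of "\<lambda>c. Poly_Mapping.single (q c) (Poly_Mapping.lookup m c)" "Poly_Mapping.keys m"]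
  by (force simp: mon_subst_def split: if_splits)

lemma var_subst_zero [simp]: "var_subst q 0 = 0"
  by (simp add: var_subst_def)

lemma var_subst_single [simp]:
  "var_subst q (Poly_Mapping.single m a) = Poly_Mapping.single (mon_subst q m) a"
  by (simp add: var_subst_def)

lemma var_subst_one [simp]: "var_subst q 1 = 1"
  using var_subst_single[of q 0 1] by simp

lemma var_subst_pvar [simp]: "var_subst q (pvar c) = pvar (q c)"
  by (simp add: pvar_def)

lemma var_subst_add: "var_subst q (f + g) = var_subst q f + var_subst q g"
proof -
  let ?A = "Poly_Mapping.keys f \<union> Poly_Mapping.keys g"
  have "Poly_Mapping.keys (f + g) \<subseteq> ?A" by (rule Poly_Mapping.keys_add)
  then show ?thesis
    by (simp add: var_subst_superset[of ?A] lookup_add single_add sum.distrib)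
qed

lemma var_subst_uminus: "var_subst q (- f) = - var_subst q f"
  by (simp add: var_subst_def single_uminus sum_negf)

lemma var_subst_diff: "var_subst q (f - g) = var_subst q f - var_subst q g"
  using var_subst_add[of q f "- g"] by (simp add: var_subst_uminus)

lemma var_subst_sum: "var_subst q (sum f A) = (\<Sum>x\<in>A. var_subst q (f x))"
  by (induction A rule: infinite_finite_induct) (simp_all add: var_subst_add)

lemma var_subst_mult: "var_subst q (f * g) = var_subst q f * var_subst q g"
proof -
  have "var_subst q (f * g) = var_subst q
      ((\<Sum>m\<in>Poly_Mapping.keys f. Poly_Mapping.single m (Poly_Mapping.lookup f m)) *
       (\<Sum>m\<in>Poly_Mapping.keys g. Poly_Mapping.single m (Poly_Mapping.lookup g m)))"
    by (simp only: poly_mapping_expand)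
  also have "\<dots> = var_subst q f * var_subst q g"
    by (simp add: sum_product var_subst_sum mult_single mon_subst_add
        var_subst_def[of q f] var_subst_def[of q g])
  finally show ?thesis .
qed

lemma keys_var_subst: "Poly_Mapping.keys (var_subst q f) \<subseteq> mon_subst q ` Poly_Mapping.keys f"
  using keys_sum[of "\<lambda>m. Poly_Mapping.single (mon_subst q m) (Poly_Mapping.lookup f m)" "Poly_Mapping.keys f"]
  by (force simp: var_subst_def split: if_splits)

lemma pvar_eq_iff: "(pvar a :: ('x, 'k::field) mpoly) = pvar b \<longleftrightarrow> a = b"
proof
  assume "(pvar a :: ('x, 'k) mpoly) = pvar b"
  then have "Poly_Mapping.keys (pvar a :: ('x, 'k) mpoly) = Poly_Mapping.keys (pvar b :: ('x, 'k) mpoly)" by simp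
  then have "Poly_Mapping.single a (1::nat) = Poly_Mapping.single b 1"
    by (simp add: pvar_def)
  then have "Poly_Mapping.keys (Poly_Mapping.single a (1::nat)) = Poly_Mapping.keys (Poly_Mapping.single b (1::nat))"
    by simp
  then show "a = b" by simp
qed simp

lemma single_one_mult:
  "Poly_Mapping.single e (1::'k::field) * f =
    (\<Sum>m\<in>Poly_Mapping.keys f. Poly_Mapping.single (e + m) (Poly_Mapping.lookup f m))"
  by (subst (1) poly_mapping_expand[of f, symmetric]) (simp add: sum_distrib_left mult_single)

lemma lookup_monomial_mult:
  fixes f :: "('x, 'k::field) mpoly"
  shows "Poly_Mapping.lookup (Poly_Mapping.single e 1 * f) (e + m) = Poly_Mapping.lookup f m"
  by (simp add: single_one_mult lookup_sum lookup_single when_def in_keys_iff)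

lemma keys_monomial_mult:
  fixes f :: "('x, 'k::field) mpoly"
  shows "Poly_Mapping.keys (Poly_Mapping.single e 1 * f) \<subseteq> (+) e ` Poly_Mapping.keys f"
  using keys_sum[of "\<lambda>m. Poly_Mapping.single (e + m) (Poly_Mapping.lookup f m)" "Poly_Mapping.keys f"]
  by (force simp: single_one_mult split: if_splits)

section \<open>Edge ideals\<close>

text \<open>The monomials divisible by \<open>x\<^sub>a x\<^sub>b\<close> for some edge \<open>(a, b)\<close>. Loops are possible in \<open>F\<close>,
  and contribute squares.\<close>

definition edge_mons :: "('x \<times> 'x) set \<Rightarrow> ('x \<Rightarrow>\<^sub>0 nat) set" where
  "edge_mons F = {Poly_Mapping.single a 1 + Poly_Mapping.single b 1 + n | a b n. (a, b) \<in> F}"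

lemma edge_monsI:
  "(a, b) \<in> F \<Longrightarrow> Poly_Mapping.single a 1 + Poly_Mapping.single b 1 + n \<in> edge_mons F"
  unfolding edge_mons_def by (intro CollectI exI conjI) (rule refl)

lemma edge_mons_add: "m \<in> edge_mons F \<Longrightarrow> m + n \<in> edge_mons F"
  by (force simp: edge_mons_def add.assoc)

lemma edge_mons_iff:
  assumes "\<And>c. (c, c) \<notin> F"
  shows "m \<in> edge_mons F \<longleftrightarrow>
    (\<exists>a b. (a, b) \<in> F \<and> Poly_Mapping.lookup m a \<noteq> 0 \<and> Poly_Mapping.lookup m b \<noteq> 0)"
proof
  assume "m \<in> edge_mons F"
  then obtain a b n where "(a, b) \<in> F" "m = Poly_Mapping.single a 1 + Poly_Mapping.single b 1 + n"
    unfolding edge_mons_def by blast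
  then show "\<exists>a b. (a, b) \<in> F \<and> Poly_Mapping.lookup m a \<noteq> 0 \<and> Poly_Mapping.lookup m b \<noteq> 0"
    by (intro exI[of _ a] exI[of _ b]) (auto simp: lookup_add lookup_single when_def)
next
  assume "\<exists>a b. (a, b) \<in> F \<and> Poly_Mapping.lookup m a \<noteq> 0 \<and> Poly_Mapping.lookup m b \<noteq> 0"
  then obtain a b where ab: "(a, b) \<in> F" "Poly_Mapping.lookup m a \<noteq> 0" "Poly_Mapping.lookup m b \<noteq> 0"
    by blast
  then have "a \<noteq> b" using assms by blast
  with ab have "m = Poly_Mapping.single a 1 + Poly_Mapping.single b 1 +
      (m - (Poly_Mapping.single a 1 + Poly_Mapping.single b 1))"
    by (intro poly_mapping_eqI) (auto simp: lookup_add lookup_minus lookup_single when_def)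
  then show "m \<in> edge_mons F" using ab(1) unfolding edge_mons_def by blast
qed

lemma edge_mons_pair:
  assumes "sym F" "Poly_Mapping.single a 1 + Poly_Mapping.single b 1 \<in> edge_mons F"
  shows "(a, b) \<in> F"
proof -
  obtain c d n where e: "Poly_Mapping.single a (1::nat) + Poly_Mapping.single b 1 =
      Poly_Mapping.single c 1 + Poly_Mapping.single d 1 + n" and cd: "(c, d) \<in> F"
    using assms(2) unfolding edge_mons_def by blast
  have l: "(if a = x then 1 else 0) + (if b = x then 1 else 0) =
    (if c = x then 1 else 0) + (if d = x then 1 else 0) + Poly_Mapping.lookup n x" for x
    using arg_cong[OF e, of "\<lambda>m. Poly_Mapping.lookup m x"] by (auto simp: lookup_add lookup_single when_def split: if_splits)
  have "a = c \<and> b = d \<or> a = d \<and> b = c"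
    using l[of c] l[of d] by (auto split: if_splits)
  then show ?thesis using cd assms(1) by (auto dest: symD)
qed

text \<open>If \<open>(x\<^sub>a - x\<^sub>b) f\<close> lies in the edge ideal, then each monomial \<open>m\<close> of \<open>f\<close> outside the ideal is
  divisible by some neighbour of \<open>a\<close>: either \<open>x\<^sub>a m\<close> lies in the ideal, or the term \<open>x\<^sub>a m\<close> cancels
  against \<open>x\<^sub>b m'\<close> for another monomial \<open>m'\<close> of \<open>f\<close>, which has a smaller exponent of \<open>x\<^sub>b\<close>, and
  induction applies to \<open>m'\<close>.\<close>

lemma neighbour_divides:
  fixes f :: "('x, 'k::field) mpoly"
  assumes F: "sym F" "\<And>c. (c, c) \<notin> F" and ab: "a \<noteq> b"
    and prod: "Poly_Mapping.keys ((pvar a - pvar b) * f) \<subseteq> edge_mons F"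
  shows "m \<in> Poly_Mapping.keys f \<Longrightarrow> m \<notin> edge_mons F \<Longrightarrow>
    \<exists>c. (a, c) \<in> F \<and> Poly_Mapping.lookup m c \<noteq> 0"
proof (induction "Poly_Mapping.lookup m b" arbitrary: m rule: less_induct)
  case less
  let ?ea = "Poly_Mapping.single a (1::nat)" and ?eb = "Poly_Mapping.single b (1::nat)"
  show ?case
  proof (cases "?ea + m \<in> edge_mons F")
    case True
    then obtain u v where uv: "(u, v) \<in> F" "Poly_Mapping.lookup (?ea + m) u \<noteq> 0"
      "Poly_Mapping.lookup (?ea + m) v \<noteq> 0"
      using edge_mons_iff F(2) by blast
    then have "(u = a \<or> Poly_Mapping.lookup m u \<noteq> 0) \<and> (v = a \<or> Poly_Mapping.lookup m v \<noteq> 0)"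
      by (auto simp: lookup_add lookup_single when_def split: if_splits)
    moreover have "\<not> (Poly_Mapping.lookup m u \<noteq> 0 \<and> Poly_Mapping.lookup m v \<noteq> 0)" "u \<noteq> v"
      using less.prems(2) uv(1) edge_mons_iff F(2) by blast+
    ultimately show ?thesis using uv(1) F(1) by (metis symD)
  next
    case False
    then have "Poly_Mapping.lookup ((pvar a - pvar b) * f) (?ea + m) = 0"
      using prod by (auto simp: in_keys_iff)
    then have "Poly_Mapping.lookup (pvar b * f) (?ea + m) = Poly_Mapping.lookup f m"
      by (simp add: left_diff_distrib lookup_minus pvar_def lookup_monomial_mult)
    then have "?ea + m \<in> Poly_Mapping.keys (pvar b * f)" using less.prems(1) by (simp add: in_keys_iff)
    then obtain m' where m': "?ea + m = ?eb + m'" "m' \<in> Poly_Mapping.keys f"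
      using keys_monomial_mult[of ?eb f] by (auto simp: pvar_def)
    have "m' \<notin> edge_mons F" using False m'(1) edge_mons_add[of m' F ?eb] by (auto simp: add.commute)
    have l: "(if a = x then 1 else 0) + Poly_Mapping.lookup m x =
      (if b = x then 1 else 0) + Poly_Mapping.lookup m' x" for x
      using arg_cong[OF m'(1), of "\<lambda>m. Poly_Mapping.lookup m x"]
      by (auto simp add: lookup_add lookup_single when_def split: if_splits)
    have "Poly_Mapping.lookup m' b < Poly_Mapping.lookup m b" using l[of b] ab by simp
    from less.hyps[OF this m'(2) \<open>m' \<notin> edge_mons F\<close>]
    obtain c where c: "(a, c) \<in> F" "Poly_Mapping.lookup m' c \<noteq> 0" by blast
    then have "c \<noteq> a" using F(2) by blast
    then have "Poly_Mapping.lookup m c \<noteq> 0" using l[of c] c(2) by auto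
    then show ?thesis using c(1) by blast
  qed
qed

text \<open>For a graph without loops, \<open>x\<^sub>a - x\<^sub>b\<close> is a nonzerodivisor modulo the edge ideal as soon as
  every neighbour of \<open>a\<close> is adjacent to every neighbour of \<open>b\<close>.\<close>

lemma variable_difference_nonzerodivisor:
  fixes f :: "('x, 'k::field) mpoly"
  assumes F: "sym F" "\<And>c. (c, c) \<notin> F" and ab: "a \<noteq> b"
    and nbr: "\<And>c d. (a, c) \<in> F \<Longrightarrow> (b, d) \<in> F \<Longrightarrow> (c, d) \<in> F"
    and prod: "Poly_Mapping.keys ((pvar a - pvar b) * f) \<subseteq> edge_mons F"
  shows "Poly_Mapping.keys f \<subseteq> edge_mons F"
proof (rule ccontr)
  assume "\<not> ?thesis"
  then obtain m where m: "m \<in> Poly_Mapping.keys f" "m \<notin> edge_mons F" by blast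
  have "(pvar b - pvar a) * f = - ((pvar a - pvar b) * f)" by (simp add: algebra_simps)
  then have "Poly_Mapping.keys ((pvar b - pvar a) * f) \<subseteq> edge_mons F"
    using prod by (simp only: keys_minus)
  then obtain c d where "(a, c) \<in> F" "Poly_Mapping.lookup m c \<noteq> 0" "(b, d) \<in> F" "Poly_Mapping.lookup m d \<noteq> 0"
    using neighbour_divides[OF F ab prod m] neighbour_divides[OF F ab[symmetric] _ m] by blast
  then show False using m(2) nbr edge_mons_iff F(2) by blast
qed

section \<open>Ideals of the polynomial ring\<close>

lemma poly_ring_simps [simp]:
  "x \<otimes>\<^bsub>poly_ring C\<^esub> y = x * y" "x \<oplus>\<^bsub>poly_ring C\<^esub> y = x + y"
  "\<one>\<^bsub>poly_ring C\<^esub> = 1" "\<zero>\<^bsub>poly_ring C\<^esub> = 0"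
  by (simp_all add: poly_ring_def)

lemma poly_ring_ring: "ring (poly_ring C)"
  using poly_ring_cring by (rule cring.axioms)

lemma poly_ring_carrier:
  "f \<in> carrier (poly_ring C) \<longleftrightarrow> (\<forall>m \<in> Poly_Mapping.keys f. Poly_Mapping.keys m \<subseteq> C)"
  by (simp add: poly_ring_def)

lemma poly_ring_a_inv:
  assumes "f \<in> carrier (poly_ring C)" shows "\<ominus>\<^bsub>poly_ring C\<^esub> f = - f"
proof -
  interpret R: cring "poly_ring C" by (rule poly_ring_cring)
  show ?thesis
    by (rule R.minus_equality) (use assms in \<open>auto simp: poly_ring_carrier\<close>)
qed

lemma pvar_carrier: "c \<in> C \<Longrightarrow> pvar c \<in> carrier (poly_ring C)"
  by (simp add: poly_ring_carrier pvar_def)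

lemma single_carrier: "Poly_Mapping.keys m \<subseteq> C \<Longrightarrow> Poly_Mapping.single m a \<in> carrier (poly_ring C)"
  by (simp add: poly_ring_carrier)

lemma poly_ring_closed:
  assumes "f \<in> carrier (poly_ring C)" "g \<in> carrier (poly_ring C)"
  shows "f + g \<in> carrier (poly_ring C)" "f * g \<in> carrier (poly_ring C)" "- f \<in> carrier (poly_ring C)"
    "f - g \<in> carrier (poly_ring C)"
proof -
  interpret R: cring "poly_ring C" by (rule poly_ring_cring)
  show *: "f + g \<in> carrier (poly_ring C)" "f * g \<in> carrier (poly_ring C)" "- f \<in> carrier (poly_ring C)"
    using R.a_closed[OF assms] R.m_closed[OF assms] R.a_inv_closed[OF assms(1)] poly_ring_a_inv[OF assms(1)]
    by simp_all
  show "f - g \<in> carrier (poly_ring C)"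
    using R.minus_closed[OF assms] poly_ring_a_inv[OF assms(2)] by (simp add: a_minus_def)
qed

lemma poly_ring_a_minus:
  assumes "f \<in> carrier (poly_ring C)" "g \<in> carrier (poly_ring C)"
  shows "f \<ominus>\<^bsub>poly_ring C\<^esub> g = f - g"
  using poly_ring_a_inv[OF assms(2)] by (simp add: a_minus_def)

lemma poly_ideal_closed:
  assumes K: "ideal K (poly_ring C)"
  shows "0 \<in> K" and "f \<in> K \<Longrightarrow> g \<in> K \<Longrightarrow> f + g \<in> K"
    and "f \<in> K \<Longrightarrow> r \<in> carrier (poly_ring C) \<Longrightarrow> r * f \<in> K"
    and "f \<in> K \<Longrightarrow> - f \<in> K" and "f \<in> K \<Longrightarrow> g \<in> K \<Longrightarrow> f - g \<in> K"
proof -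
  interpret K: ideal K "poly_ring C" by fact
  show "0 \<in> K" using additive_subgroup.zero_closed[OF ideal.axioms(1)[OF K]] by simp
  show add: "f + g \<in> K" if "f \<in> K" "g \<in> K" for f g
    using additive_subgroup.a_closed[OF ideal.axioms(1)[OF K] that] by simp
  show "r * f \<in> K" if "f \<in> K" "r \<in> carrier (poly_ring C)" using K.I_l_closed that by simp
  show neg: "- f \<in> K" if "f \<in> K" for f
    using additive_subgroup.a_inv_closed[OF ideal.axioms(1)[OF K] that]
      K.Icarr[OF that] poly_ring_a_inv[of f C] by simp
  show "f - g \<in> K" if "f \<in> K" "g \<in> K" using add[OF that(1) neg[OF that(2)]] by simp
qed

lemma poly_ideal_sum:
  assumes "ideal K (poly_ring C)" "\<And>x. x \<in> A \<Longrightarrow> f x \<in> K"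
  shows "sum f A \<in> K"
  using assms(2)
  by (induction A rule: infinite_finite_induct) (use poly_ideal_closed[OF assms(1)] in auto)

lemma poly_ideal_subspace:
  assumes "ideal K (poly_ring C)" shows "lin.subspace K"
  by (rule lin.subspaceI)
     (use poly_ideal_closed[OF assms] in \<open>auto simp: poly_scale_def single_carrier\<close>)

lemma variable_differencesE:
  assumes "f \<in> variable_differences C"
  obtains c d where "f = pvar c - pvar d" "c \<in> C" "d \<in> C"
  using assms by (auto simp: variable_differences_def)

text \<open>The preimage, under a substitution, of an ideal spanned by monomials.\<close>

lemma subst_ideal:
  assumes N: "\<And>m n. m \<in> N \<Longrightarrow> m + n \<in> N"
  shows "ideal {f \<in> carrier (poly_ring C). Poly_Mapping.keys (var_subst q f) \<subseteq> N} (poly_ring C)"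
    (is "ideal ?K ?R")
proof -
  interpret R: cring ?R by (rule poly_ring_cring)
  have prod: "x * f \<in> ?K" if "f \<in> ?K" "x \<in> carrier ?R" for f x
  proof -
    have "Poly_Mapping.keys (var_subst q x * var_subst q f) \<subseteq> N"
    proof
      fix m assume "m \<in> Poly_Mapping.keys (var_subst q x * var_subst q f)"
      then obtain a b where "m = a + b" "b \<in> Poly_Mapping.keys (var_subst q f)"
        using keys_mult[of "var_subst q x" "var_subst q f"] by blast
      then show "m \<in> N" using that(1) N[of b a] by (auto simp: add.commute)
    qed
    then show ?thesis using that poly_ring_closed(2)[of x C f] by (simp add: var_subst_mult)
  qed
  have "subgroup ?K (add_monoid ?R)"
  proof (rule R.add.subgroupI)
    show "?K \<noteq> {}" using R.zero_closed by (auto intro!: exI[of _ 0])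
    fix f assume f: "f \<in> ?K"
    then show "\<ominus>\<^bsub>?R\<^esub> f \<in> ?K"
      using poly_ring_closed(3)[of f C] by (auto simp: poly_ring_a_inv var_subst_uminus)
    fix g assume g: "g \<in> ?K"
    show "f \<oplus>\<^bsub>?R\<^esub> g \<in> ?K"
      using f g poly_ring_closed(1)[of f C g] Poly_Mapping.keys_add[of "var_subst q f" "var_subst q g"]
      by (auto simp: var_subst_add)
  qed auto
  then show ?thesis
    by (rule idealI[OF R.ring_axioms]) (use prod in \<open>auto simp: mult.commute\<close>)
qed

text \<open>A monomial and its image are congruent modulo an ideal that contains the differences
  \<open>x\<^sub>c - x\<^bsub>q c\<^esub>\<close>.\<close>

lemma monomial_subst_mem:
  assumes K: "ideal K (poly_ring C)"
    and q: "\<And>c. c \<in> C \<Longrightarrow> q c \<in> C \<and> pvar c - pvar (q c) \<in> K"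
  shows "Poly_Mapping.keys m \<subseteq> C \<Longrightarrow>
    Poly_Mapping.single m (1::'k::field) - Poly_Mapping.single (mon_subst q m) 1 \<in> K"
proof (induction "\<Sum>c\<in>Poly_Mapping.keys m. Poly_Mapping.lookup m c" arbitrary: m rule: less_induct)
  case less
  show ?case
  proof (cases "m = 0")
    case True
    then show ?thesis using poly_ideal_closed(1)[OF K] by simp
  next
    case False
    then obtain c where c: "c \<in> Poly_Mapping.keys m" by (metis ex_in_conv keys_eq_empty)
    define m' where "m' = m - Poly_Mapping.single c 1"
    have m: "m = Poly_Mapping.single c 1 + m'"
      using c by (intro poly_mapping_eqI) (auto simp: m'_def lookup_add lookup_minus lookup_single when_def in_keys_iff)
    have sub: "Poly_Mapping.keys m' \<subseteq> Poly_Mapping.keys m"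
      by (auto simp: m'_def lookup_minus in_keys_iff)
    have "(\<Sum>c\<in>Poly_Mapping.keys m'. Poly_Mapping.lookup m' c) = (\<Sum>c\<in>Poly_Mapping.keys m. Poly_Mapping.lookup m' c)"
      using sub by (intro sum.mono_neutral_left) (auto simp: in_keys_iff)
    also have "\<dots> < (\<Sum>c\<in>Poly_Mapping.keys m. Poly_Mapping.lookup m c)"
      using c by (intro sum_strict_mono_ex1)
        (auto simp: m lookup_add lookup_single when_def intro!: bexI[of _ c])
    finally have IH: "Poly_Mapping.single m' 1 - Poly_Mapping.single (mon_subst q m') 1 \<in> K"
      using less sub by blast
    have cC: "c \<in> C" using c less.prems by blast
    let ?x = "Poly_Mapping.single m' (1::'k)" and ?y = "Poly_Mapping.single (mon_subst q m') (1::'k)"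
    have "Poly_Mapping.keys (mon_subst q m') \<subseteq> C"
      using keys_mon_subst[of q m'] q sub less.prems by blast
    then have "pvar c * (?x - ?y) + ?y * (pvar c - pvar (q c)) \<in> K"
      by (intro poly_ideal_closed(2,3)[OF K] IH pvar_carrier[OF cC] single_carrier) (use q[OF cC] in auto)
    moreover have "pvar c * (?x - ?y) + ?y * (pvar c - pvar (q c)) = pvar c * ?x - pvar (q c) * ?y"
      by (simp add: algebra_simps)
    ultimately show ?thesis
      by (simp add: m mon_subst_add pvar_def mult_single)
  qed
qed

lemma mem_ideal_if_subst:
  fixes f :: "('x, 'k::field) mpoly"
  assumes K: "ideal K (poly_ring C)"
    and q: "\<And>c. c \<in> C \<Longrightarrow> q c \<in> C \<and> pvar c - pvar (q c) \<in> K"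
    and F: "F \<subseteq> C \<times> C" "\<And>a b. (a, b) \<in> F \<Longrightarrow> pvar a * pvar b \<in> K"
    and f: "f \<in> carrier (poly_ring C)"
      "Poly_Mapping.keys (var_subst q f) \<subseteq> edge_mons (map_prod q q ` F)"
  shows "f \<in> K"
proof -
  have "f - var_subst q f = (\<Sum>m\<in>Poly_Mapping.keys f. Poly_Mapping.single 0 (Poly_Mapping.lookup f m) *
      (Poly_Mapping.single m 1 - Poly_Mapping.single (mon_subst q m) 1))"
    by (subst (1) poly_mapping_expand[of f, symmetric])
       (simp add: var_subst_def sum_subtractf right_diff_distrib mult_single)
  also have "\<dots> \<in> K"
    using poly_ideal_closed(3)[OF K] monomial_subst_mem[OF K q] f(1)
    by (intro poly_ideal_sum[OF K]) (auto simp: poly_ring_carrier single_carrier)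
  finally have diff: "f - var_subst q f \<in> K" .
  have "Poly_Mapping.single n a \<in> K" if n: "n \<in> Poly_Mapping.keys (var_subst q f)" for n a
  proof -
    obtain u v n' where uv: "(u, v) \<in> F"
      and e: "n = Poly_Mapping.single (q u) 1 + Poly_Mapping.single (q v) 1 + n'"
      using f(2) n by (auto simp: edge_mons_def)
    obtain m where m: "m \<in> Poly_Mapping.keys f" "n = mon_subst q m"
      using n keys_var_subst[of q f] by blast
    then have "Poly_Mapping.keys m \<subseteq> C" using f(1) by (simp add: poly_ring_carrier)
    then have "Poly_Mapping.keys n \<subseteq> C" using keys_mon_subst[of q m] q m(2) by blast
    moreover have "Poly_Mapping.keys n' \<subseteq> Poly_Mapping.keys n"
      by (auto simp: e lookup_add in_keys_iff)
    ultimately have n'C: "Poly_Mapping.keys n' \<subseteq> C" by blast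
    have C: "u \<in> C" "v \<in> C" using uv F by auto
    have "pvar v * (pvar u - pvar (q u)) \<in> K" "pvar (q u) * (pvar v - pvar (q v)) \<in> K"
      using C q by (auto intro!: poly_ideal_closed(3)[OF K] pvar_carrier)
    then have "pvar u * pvar v - (pvar v * (pvar u - pvar (q u)) + pvar (q u) * (pvar v - pvar (q v))) \<in> K"
      by (intro poly_ideal_closed(5)[OF K F(2)[OF uv]] poly_ideal_closed(2)[OF K])
    then have "pvar (q u) * pvar (q v) \<in> K" by (simp add: algebra_simps)
    then have "Poly_Mapping.single n' a * (pvar (q u) * pvar (q v)) \<in> K"
      using poly_ideal_closed(3)[OF K] n'C single_carrier by blast
    then show ?thesis by (simp add: pvar_def mult_single e add_ac)
  qed
  then have "var_subst q f \<in> K"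
    by (subst poly_mapping_expand[symmetric]) (auto intro: poly_ideal_sum[OF K])
  then show ?thesis using poly_ideal_closed(2)[OF K diff] by force
qed

text \<open>The edge ideal of the relation \<open>F\<close>, as an ideal of \<open>k[x\<^sub>c | c \<in> C]\<close>.\<close>

definition edge_ideal :: "'x set \<Rightarrow> ('x \<times> 'x) set \<Rightarrow> ('x, 'k::field) mpoly set" where
  "edge_ideal C F = Idl\<^bsub>poly_ring C\<^esub> {pvar a * pvar b | a b. (a, b) \<in> F}"

section \<open>Identifying variables\<close>

text \<open>A representative of the class of the variable \<open>c\<close> modulo the subspace \<open>L\<close>. Polynomials modulo
  \<open>(L)\<close> are represented by substituting these representatives.\<close>

definition class_rep :: "'x set \<Rightarrow> ('x, 'k::field) mpoly set \<Rightarrow> 'x \<Rightarrow> 'x" where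
  "class_rep C L c = (SOME d. d \<in> C \<and> pvar c - pvar d \<in> L)"

text \<open>An edge relation \<open>F\<close> on \<open>C\<close> together with a set \<open>D\<close> of variable differences. The differences
  identify the variables \<open>a\<close> and \<open>b\<close> if \<open>x\<^sub>a - x\<^sub>b\<close> lies in their linear span.\<close>

locale var_ident =
  fixes C :: "'x set" and F :: "('x \<times> 'x) set" and D :: "('x, 'k::field) mpoly set"
  assumes F: "F \<subseteq> C \<times> C" and D: "D \<subseteq> variable_differences C"
begin

abbreviation "q \<equiv> class_rep C (lin.span D)"
abbreviation "R \<equiv> poly_ring C :: ('x, 'k) mpoly ring"
abbreviation "I \<equiv> edge_ideal C F :: ('x, 'k) mpoly set"
abbreviation "ident a b \<equiv> pvar a - pvar b \<in> lin.span D"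

lemma ident_refl: "ident a a" by (simp add: lin.span_zero)
lemma ident_sym: "ident a b \<Longrightarrow> ident b a"
  using lin.span_neg[of "pvar a - pvar b" D] by simp
lemma ident_trans: "ident a b \<Longrightarrow> ident b c \<Longrightarrow> ident a c"
  using lin.span_add[of "pvar a - pvar b" D "pvar b - pvar c"] by simp

lemma rep: "c \<in> C \<Longrightarrow> q c \<in> C \<and> ident c (q c)"
  unfolding class_rep_def by (rule someI[of _ c]) (simp add: lin.span_zero)

lemma rep_eq_iff: "a \<in> C \<Longrightarrow> b \<in> C \<Longrightarrow> q a = q b \<longleftrightarrow> ident a b"
proof
  assume "a \<in> C" "b \<in> C" "q a = q b"
  then show "ident a b" using rep[of a] rep[of b] ident_sym ident_trans by metis
next
  assume "ident a b"
  then have "ident a d \<longleftrightarrow> ident b d" for d using ident_sym ident_trans by blast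
  then show "q a = q b" unfolding class_rep_def by simp
qed

lemma subst_diff: "d \<in> lin.span D \<Longrightarrow> var_subst q d = 0"
proof -
  have "lin.span D \<subseteq> {d. var_subst q d = 0}"
  proof (rule lin.span_minimal)
    show "D \<subseteq> {d. var_subst q d = 0}"
    proof
      fix d assume d: "d \<in> D"
      then obtain a b where ab: "d = pvar a - pvar b" "a \<in> C" "b \<in> C"
        using D by (auto simp: variable_differences_def)
      then have "q a = q b" using rep_eq_iff lin.span_base[OF d] by blast
      then show "d \<in> {d. var_subst q d = 0}" by (simp add: ab(1) var_subst_diff)
    qed
    show "lin.subspace {d. var_subst q d = 0}"
      by (rule lin.subspaceI) (simp_all add: var_subst_add var_subst_mult poly_scale_def)
  qed
  then show "d \<in> lin.span D \<Longrightarrow> var_subst q d = 0" by blast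
qed

lemma D_carrier: "D \<subseteq> carrier R"
proof
  fix d assume "d \<in> D"
  then obtain a b where "d = pvar a - pvar b" "a \<in> C" "b \<in> C"
    using D by (auto simp: variable_differences_def)
  then show "d \<in> carrier R" by (simp add: poly_ring_closed(4) pvar_carrier)
qed

lemma gens_carrier: "{pvar a * pvar b | a b. (a, b) \<in> F} \<subseteq> carrier R"
proof safe
  fix a b assume "(a, b) \<in> F"
  then have "a \<in> C" "b \<in> C" using F by auto
  then show "pvar a * pvar b \<in> carrier R" by (simp add: poly_ring_closed(2) pvar_carrier)
qed

lemma edge_ideal_ideal: "ideal (I) R"
  unfolding edge_ideal_def by (rule ring.genideal_ideal[OF poly_ring_ring gens_carrier])

lemma edge_ideal_carrier: "I \<subseteq> carrier R"
  using ideal.Icarr[OF edge_ideal_ideal] by blast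

lemma gens_ideal: "(a, b) \<in> F \<Longrightarrow> pvar a * pvar b \<in> I"
  unfolding edge_ideal_def
  by (rule subsetD[OF ring.genideal_self[OF poly_ring_ring gens_carrier]]) auto

text \<open>The edge relation of the quotient graph. Dividing by the differences turns the edge ideal of \<open>F\<close>
  into that of \<open>F'\<close>: this is \<open>mem_ideal_iff\<close>.\<close>

abbreviation "F' \<equiv> map_prod q q ` F"

lemma mem_ideal_iff:
  "f \<in> Idl\<^bsub>R\<^esub> (I \<union> D) \<longleftrightarrow>
    f \<in> carrier R \<and> Poly_Mapping.keys (var_subst q f) \<subseteq> edge_mons F'" (is "f \<in> ?J \<longleftrightarrow> f \<in> carrier R \<and> ?P f")
proof -
  interpret R: ring R by (rule poly_ring_ring)
  have sub: "I \<union> D \<subseteq> carrier R" using edge_ideal_carrier D_carrier by blast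
  have J: "ideal ?J R" "I \<union> D \<subseteq> ?J"
    using R.genideal_ideal[OF sub] R.genideal_self[OF sub] by blast+
  then have span: "lin.span D \<subseteq> ?J" using poly_ideal_subspace lin.span_minimal by blast
  have K: "ideal {f \<in> carrier R. ?P f} R"
    by (rule subst_ideal) (rule edge_mons_add)
  have "I \<subseteq> {f \<in> carrier R. ?P f}"
    unfolding edge_ideal_def
  proof (rule R.genideal_minimal[OF K], safe)
    fix a b assume ab: "(a, b) \<in> F"
    then show "pvar a * pvar b \<in> carrier R" by (intro subsetD[OF gens_carrier]) auto
    have "Poly_Mapping.single (q a) (1::nat) + Poly_Mapping.single (q b) 1 + 0 \<in> edge_mons F'"
      using ab unfolding edge_mons_def by (intro CollectI exI conjI) (rule refl, force)
    then show "m \<in> edge_mons F'" if "m \<in> Poly_Mapping.keys (var_subst q (pvar a * pvar b :: ('x, 'k) mpoly))" for m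
      using that by (simp add: var_subst_mult pvar_def mult_single mon_subst_add)
  qed
  moreover have "D \<subseteq> {f \<in> carrier R. ?P f}"
    using D_carrier subst_diff lin.span_base by fastforce
  ultimately have "?J \<subseteq> {f \<in> carrier R. ?P f}"
    by (intro R.genideal_minimal[OF K]) blast
  moreover have "f \<in> ?J" if "f \<in> carrier R" "?P f"
  proof (rule mem_ideal_if_subst[OF J(1) _ F _ that])
    show "q c \<in> C \<and> pvar c - pvar (q c) \<in> ?J" if "c \<in> C" for c
      using rep[OF that] span by blast
    show "pvar a * pvar b \<in> ?J" if "(a, b) \<in> F" for a b
      using gens_ideal[OF that] J(2) by blast
  qed
  ultimately show ?thesis by blast
qed

lemma mem_linear_ideal_iff:
  "f \<in> Idl\<^bsub>R\<^esub> (lin.span D) \<longleftrightarrow> f \<in> carrier R \<and> var_subst q f = 0" (is "f \<in> ?J \<longleftrightarrow> _")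
proof -
  interpret R: ring R by (rule poly_ring_ring)
  have K: "ideal {f \<in> carrier R. Poly_Mapping.keys (var_subst q f) \<subseteq> {}} R"
    by (rule subst_ideal) simp
  have sub: "lin.span D \<subseteq> carrier R"
    by (rule lin.span_minimal[OF D_carrier poly_ideal_subspace[OF R.oneideal]])
  have J: "ideal ?J R" "lin.span D \<subseteq> ?J"
    using R.genideal_ideal[OF sub] R.genideal_self[OF sub] by blast+
  have "?J \<subseteq> {f \<in> carrier R. Poly_Mapping.keys (var_subst q f) \<subseteq> {}}"
    by (rule R.genideal_minimal[OF K]) (use sub subst_diff in auto)
  moreover have "f \<in> ?J" if "f \<in> carrier R" "var_subst q f = 0"
  proof (rule mem_ideal_if_subst[OF J(1), of q "{}"])
    show "q c \<in> C \<and> pvar c - pvar (q c) \<in> ?J" if "c \<in> C" for c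
      using rep[OF that] J(2) by blast
  qed (use that in simp_all)
  ultimately show ?thesis by auto
qed

end

section \<open>Regular sequences and squarefree quotients\<close>

lemma quot_simps:
  assumes "ideal J R"
  shows "carrier (R Quot J) = (\<lambda>x. J +>\<^bsub>R\<^esub> x) ` carrier R" "\<zero>\<^bsub>R Quot J\<^esub> = J"
    "x \<in> carrier R \<Longrightarrow> y \<in> carrier R \<Longrightarrow> (J +>\<^bsub>R\<^esub> x) \<otimes>\<^bsub>R Quot J\<^esub> (J +>\<^bsub>R\<^esub> y) = J +>\<^bsub>R\<^esub> (x \<otimes>\<^bsub>R\<^esub> y)"
    "\<one>\<^bsub>R Quot J\<^esub> = J +>\<^bsub>R\<^esub> \<one>\<^bsub>R\<^esub>"
  using ring_hom_mult[OF ideal.rcos_ring_hom[OF assms], of x y]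
  by (auto simp: FactRing_def A_RCOSETS_def')

lemma nonzerodivisor_quot_iff:
  assumes R: "ring R" and J: "ideal J R" and g: "g \<in> carrier R"
  shows "nonzerodivisor (R Quot J) (J +>\<^bsub>R\<^esub> g) \<longleftrightarrow>
    (\<forall>f \<in> carrier R. g \<otimes>\<^bsub>R\<^esub> f \<in> J \<longrightarrow> f \<in> J)"
proof -
  have zero: "J +>\<^bsub>R\<^esub> f = J \<longleftrightarrow> f \<in> J" if "f \<in> carrier R" for f
    using that ideal.rcos_const_imp_mem[OF J] ring.a_rcos_zero[OF R J] by blast
  have "g \<otimes>\<^bsub>R\<^esub> f \<in> carrier R" if "f \<in> carrier R" for f
    using R g that by (simp add: ring.ring_simprules)
  then show ?thesis
    using g by (simp add: nonzerodivisor_def quot_simps[OF J] zero)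
qed

lemma image_genideal:
  assumes R: "ring R" and J: "ideal J R" and S: "S \<subseteq> carrier R"
  shows "(\<lambda>x. J +>\<^bsub>R\<^esub> x) ` (Idl\<^bsub>R\<^esub> S) = Idl\<^bsub>R Quot J\<^esub> ((\<lambda>x. J +>\<^bsub>R\<^esub> x) ` S)"
    (is "?h ` ?I = ?K")
proof (rule antisym)
  interpret R: ring R by fact
  interpret B: ring "R Quot J" by (rule ideal.quotient_is_ring[OF J])
  have hS: "?h ` S \<subseteq> carrier (R Quot J)" using S by (auto simp: quot_simps[OF J])
  show "?K \<subseteq> ?h ` ?I"
    using R.ring_ideal_imp_quot_ideal[OF J R.genideal_ideal[OF S]] R.genideal_self[OF S]
    by (intro B.genideal_minimal image_mono)
  have "?I \<subseteq> {r \<in> carrier R. ?h r \<in> ?K}"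
    using S B.genideal_self[OF hS]
    by (intro R.genideal_minimal ring_hom_ring.ideal_vimage[OF ideal.rcos_ring_hom_ring[OF J]]
        B.genideal_ideal[OF hS]) blast
  then show "?h ` ?I \<subseteq> ?K" by blast
qed

context var_ident
begin

abbreviation "J \<equiv> Idl\<^bsub>R\<^esub> (I \<union> D)"

lemma J_ideal: "ideal J R"
  using ring.genideal_ideal[OF poly_ring_ring] edge_ideal_carrier D_carrier by blast

lemma J_proper: "J \<noteq> carrier R"
proof
  assume "J = carrier R"
  moreover have "1 \<in> carrier R" by (simp add: poly_ring_carrier)
  ultimately have "1 \<in> J" by simp
  then have "Poly_Mapping.keys (var_subst q (1 :: ('x, 'k) mpoly)) \<subseteq> edge_mons F'"
    unfolding mem_ideal_iff by blast
  then have "(0 :: 'x \<Rightarrow>\<^sub>0 nat) \<in> edge_mons F'" by simp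
  then obtain a b n where "(0 :: 'x \<Rightarrow>\<^sub>0 nat) = Poly_Mapping.single a 1 + Poly_Mapping.single b 1 + n"
    unfolding edge_mons_def by blast
  from arg_cong[OF this, of "\<lambda>m. Poly_Mapping.lookup m a"] show False by (simp add: lookup_add)
qed

lemma difference_carrier: "a \<in> C \<Longrightarrow> b \<in> C \<Longrightarrow> pvar a - pvar b \<in> carrier R"
  by (simp add: poly_ring_closed(4) pvar_carrier)

text \<open>It suffices that the neighbour condition holds in the original graph for all variables
  identified with \<open>a0\<close> and \<open>b0\<close>.\<close>

lemma ident_nonzerodivisor:
  assumes "sym F" and noloop: "\<And>a b. (a, b) \<in> F \<Longrightarrow> \<not> ident a b"
    and ab: "a0 \<in> C" "b0 \<in> C" "\<not> ident a0 b0"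
    and nbr: "\<And>a b c d. ident a a0 \<Longrightarrow> ident b b0 \<Longrightarrow> (a, c) \<in> F \<Longrightarrow> (b, d) \<in> F \<Longrightarrow> (c, d) \<in> F"
  shows "nonzerodivisor (R Quot J) (J +>\<^bsub>R\<^esub> (pvar a0 - pvar b0))"
proof -
  have F'_sym: "sym F'" using \<open>sym F\<close> by (fastforce simp: sym_def)
  have F'_noloop: "(c, c) \<notin> F'" for c
  proof
    assume "(c, c) \<in> F'"
    then obtain a b where "(a, b) \<in> F" "q a = q b" by auto
    then show False using noloop rep_eq_iff F by blast
  qed
  have F'_nbr: "(c, d) \<in> F'" if cd: "(q a0, c) \<in> F'" "(q b0, d) \<in> F'" for c d
  proof -
    obtain a c1 b d1 where e: "(a, c1) \<in> F" "q a0 = q a" "c = q c1" "(b, d1) \<in> F" "q b0 = q b" "d = q d1"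
      using cd by auto
    then have "ident a a0" "ident b b0" using rep_eq_iff F ab by (metis mem_Sigma_iff subsetD)+
    then have "(c1, d1) \<in> F" using nbr e by blast
    then show ?thesis using e by force
  qed
  have "q a0 \<noteq> q b0" using rep_eq_iff ab by blast
  note nzd = variable_difference_nonzerodivisor[OF F'_sym F'_noloop this F'_nbr]
  have "f \<in> J" if f: "f \<in> carrier R" "(pvar a0 - pvar b0) * f \<in> J" for f
  proof -
    have "Poly_Mapping.keys ((pvar (q a0) - pvar (q b0)) * var_subst q f) \<subseteq> edge_mons F'"
      using f(2) by (simp add: mem_ideal_iff var_subst_mult var_subst_diff)
    then show ?thesis using nzd f(1) by (simp add: mem_ideal_iff)
  qed
  then show ?thesis
    by (subst nonzerodivisor_quot_iff[OF poly_ring_ring J_ideal difference_carrier]) (use ab in auto)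
qed

text \<open>Conversely, if neighbours \<open>c\<close> of \<open>a0\<close> and \<open>d\<close> of \<open>b0\<close> are not adjacent in the quotient graph,
  then \<open>x\<^sub>c x\<^sub>d\<close> is a nonzero class annihilated by \<open>x\<^bsub>a0\<^esub> - x\<^bsub>b0\<^esub>\<close>.\<close>

lemma ident_nonzerodivisorD:
  assumes "sym F" and ab: "a0 \<in> C" "b0 \<in> C"
    and nzd: "nonzerodivisor (R Quot J) (J +>\<^bsub>R\<^esub> (pvar a0 - pvar b0))"
    and "ident a a0" "ident b b0" "(a, c) \<in> F" "(b, d) \<in> F"
  shows "\<exists>c' d'. (c', d') \<in> F \<and> ident c' c \<and> ident d' d"
proof -
  have F'_sym: "sym F'" using \<open>sym F\<close> by (fastforce simp: sym_def)
  have C: "a \<in> C" "b \<in> C" "c \<in> C" "d \<in> C" using F assms(7,8) by auto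
  have q: "q a0 = q a" "q b0 = q b" using assms(5,6) rep_eq_iff C ab by metis+
  let ?ec = "Poly_Mapping.single (q c) (1::nat)" and ?ed = "Poly_Mapping.single (q d) (1::nat)"
  let ?f = "pvar c * pvar d :: ('x, 'k) mpoly"
  have f: "?f \<in> carrier R" using C by (simp add: poly_ring_closed(2) pvar_carrier)
  have mono: "Poly_Mapping.single (Poly_Mapping.single u 1 + (?ec + ?ed)) (1::'k) =
      pvar u * (pvar (q c) * pvar (q d))" for u
    by (simp add: pvar_def mult_single)
  have sub: "Poly_Mapping.keys (pvar u * (pvar (q c) * pvar (q d)) :: ('x, 'k) mpoly) \<subseteq> edge_mons F'"
    if u: "u = q a \<or> u = q b" for u
  proof -
    have "Poly_Mapping.single u 1 + (?ec + ?ed) \<in> edge_mons F'"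
    proof (cases "u = q a")
      case True
      have "(q a, q c) \<in> F'" using assms(7) by force
      moreover have "Poly_Mapping.single u 1 + (?ec + ?ed) = Poly_Mapping.single (q a) 1 + ?ec + ?ed"
        by (simp add: True add_ac)
      ultimately show ?thesis by (simp only: edge_monsI)
    next
      case False
      then have "(q b, q d) \<in> F'" "u = q b" using assms(8) u by force+
      moreover have "Poly_Mapping.single (q b) 1 + (?ec + ?ed) = Poly_Mapping.single (q b) 1 + ?ed + ?ec"
        by (simp add: add_ac)
      ultimately show ?thesis by (simp only: edge_monsI)
    qed
    then show ?thesis unfolding mono[symmetric] by simp
  qed
  have "Poly_Mapping.keys (var_subst q ((pvar a0 - pvar b0) * ?f)) \<subseteq> edge_mons F'"
  proof -
    have "var_subst q ((pvar a0 - pvar b0) * ?f) =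
        pvar (q a) * (pvar (q c) * pvar (q d)) - pvar (q b) * (pvar (q c) * pvar (q d))"
      by (simp add: var_subst_mult var_subst_diff q left_diff_distrib)
    then show ?thesis
      using sub[of "q a"] sub[of "q b"]
        keys_diff[of "pvar (q a) * (pvar (q c) * pvar (q d)) :: ('x, 'k) mpoly"
          "pvar (q b) * (pvar (q c) * pvar (q d))"] by auto
  qed
  then have "(pvar a0 - pvar b0) * ?f \<in> J"
    by (simp add: mem_ideal_iff poly_ring_closed(2) difference_carrier ab f)
  then have "?f \<in> J"
    using nzd f by (simp add: nonzerodivisor_quot_iff[OF poly_ring_ring J_ideal difference_carrier] ab)
  moreover have "Poly_Mapping.keys (var_subst q ?f) = {?ec + ?ed}"
    by (simp add: var_subst_mult pvar_def mult_single mon_subst_add)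
  ultimately have "?ec + ?ed \<in> edge_mons F'" by (simp add: mem_ideal_iff)
  then have "(q c, q d) \<in> F'" by (rule edge_mons_pair[OF F'_sym])
  then obtain c' d' where cd: "(c', d') \<in> F" "q c = q c'" "q d = q d'" by auto
  then have "ident c' c" "ident d' d" using rep_eq_iff C F by (metis mem_Sigma_iff subsetD)+
  then show ?thesis using cd(1) by blast
qed

lemma proj_eq_iff:
  assumes "f \<in> carrier R" "g \<in> carrier R"
  shows "Idl\<^bsub>R\<^esub> (lin.span D) +>\<^bsub>R\<^esub> f = Idl\<^bsub>R\<^esub> (lin.span D) +>\<^bsub>R\<^esub> g \<longleftrightarrow> var_subst q f = var_subst q g"
proof -
  have "lin.span D \<subseteq> carrier R"
    by (rule lin.span_minimal[OF D_carrier poly_ideal_subspace[OF ring.oneideal[OF poly_ring_ring]]])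
  then have "ideal (Idl\<^bsub>R\<^esub> (lin.span D)) R" by (rule ring.genideal_ideal[OF poly_ring_ring])
  from ring.quotient_eq_iff_same_a_r_cos[OF poly_ring_ring this assms]
  show ?thesis using assms
    by (simp add: poly_ring_a_minus mem_linear_ideal_iff poly_ring_closed(4) var_subst_diff)
qed

text \<open>The quotient is squarefree exactly if no edge is contracted to a loop. For the nontrivial
  direction, a squarefree monomial in the image of the edge ideal is divisible by two different
  variables, so the same holds for every monomial of the ideal that such monomials generate; a
  contracted edge yields the square of a variable.\<close>

lemma squarefree_quotient_iff:
  "squarefree_quotient C I (lin.span D) \<longleftrightarrow> (\<forall>(a, b) \<in> F. \<not> ident a b)"
proof -
  define L where "L = Idl\<^bsub>R\<^esub> (lin.span D)"
  define B where "B = R Quot L"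
  define h where "h = (\<lambda>x. L +>\<^bsub>R\<^esub> x)"
  define gens :: "('x, 'k) mpoly set" where "gens = {pvar a * pvar b | a b. (a, b) \<in> F}"
  interpret R: cring R by (rule poly_ring_cring)
  have span_carrier: "lin.span D \<subseteq> carrier R"
    by (rule lin.span_minimal[OF D_carrier poly_ideal_subspace[OF R.oneideal]])
  have L: "ideal L R" unfolding L_def by (rule R.genideal_ideal[OF span_carrier])
  interpret B: cring B unfolding B_def by (rule ideal.quotient_is_cring[OF L R.is_cring])
  have h_eq: "h f = h g \<longleftrightarrow> var_subst q f = var_subst q g" if "f \<in> carrier R" "g \<in> carrier R" for f g
    using proj_eq_iff[OF that] by (simp add: h_def L_def)
  have h_var: "h (pvar a) = h (pvar b) \<longleftrightarrow> ident a b" if "a \<in> C" "b \<in> C" for a b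
    using that by (simp add: h_eq pvar_carrier pvar_eq_iff rep_eq_iff)
  have h_carrier: "f \<in> carrier R \<Longrightarrow> h f \<in> carrier B" for f
    by (simp add: h_def B_def quot_simps[OF L])
  have h_mult: "f \<in> carrier R \<Longrightarrow> g \<in> carrier R \<Longrightarrow> h f \<otimes>\<^bsub>B\<^esub> h g = h (f * g)" for f g
    by (simp add: h_def B_def quot_simps[OF L])
  have h_one: "\<one>\<^bsub>B\<^esub> = h 1" by (simp add: h_def B_def quot_simps[OF L])
  define Y where "Y = (\<lambda>c. h (pvar c)) ` C"
  have sf: "squarefree_quotient C I (lin.span D) \<longleftrightarrow>
    (\<exists>M \<subseteq> {finprod B (\<lambda>y. y) A | A. A \<subseteq> Y}. h ` I = Idl\<^bsub>B\<^esub> M)"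
    by (simp add: squarefree_quotient_def Let_def h_def B_def L_def Y_def)
  show ?thesis unfolding sf
  proof
    assume noloop: "\<forall>(a, b) \<in> F. \<not> ident a b"
    have prod2: "finprod B (\<lambda>y. y) {h (pvar a), h (pvar b)} = h (pvar a * pvar b)" if "(a, b) \<in> F" for a b
    proof -
      have C: "a \<in> C" "b \<in> C" using that F by auto
      then have "h (pvar a) \<noteq> h (pvar b)" using h_var noloop that by blast
      then show ?thesis using C by (simp add: h_carrier pvar_carrier h_mult)
    qed
    have "h ` gens \<subseteq> {finprod B (\<lambda>y. y) A | A. A \<subseteq> Y}"
    proof safe
      fix x assume "x \<in> gens"
      then obtain a b where ab: "(a, b) \<in> F" "x = pvar a * pvar b" by (auto simp: gens_def)
      then have "{h (pvar a), h (pvar b)} \<subseteq> Y" using F by (auto simp: Y_def)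
      then show "\<exists>A. h x = finprod B (\<lambda>y. y) A \<and> A \<subseteq> Y" using prod2[OF ab(1)] ab(2) by metis
    qed
    moreover have "h ` I = Idl\<^bsub>B\<^esub> (h ` gens)"
      unfolding h_def B_def edge_ideal_def gens_def by (rule image_genideal[OF R.ring_axioms L gens_carrier])
    ultimately show "\<exists>M \<subseteq> {finprod B (\<lambda>y. y) A | A. A \<subseteq> Y}. h ` I = Idl\<^bsub>B\<^esub> M" by blast
  next
    assume "\<exists>M \<subseteq> {finprod B (\<lambda>y. y) A | A. A \<subseteq> Y}. h ` I = Idl\<^bsub>B\<^esub> M"
    then obtain M where M: "M \<subseteq> {finprod B (\<lambda>y. y) A | A. A \<subseteq> Y}" "h ` I = Idl\<^bsub>B\<^esub> M" by blast
    define N where "N = {n :: 'x \<Rightarrow>\<^sub>0 nat. \<exists>u v. u \<noteq> v \<and> Poly_Mapping.lookup n u \<noteq> 0 \<and> Poly_Mapping.lookup n v \<noteq> 0}"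
    define K where "K = {f \<in> carrier R. Poly_Mapping.keys (var_subst q f) \<subseteq> N}"
    have K: "ideal K R"
      unfolding K_def by (rule subst_ideal) (auto simp: N_def lookup_add)
    have I_keys: "Poly_Mapping.keys (var_subst q g) \<subseteq> edge_mons F'" if "g \<in> I" for g
    proof -
      have "g \<in> J"
        using R.genideal_self[of "I \<union> D"] edge_ideal_carrier D_carrier that by blast
      then show ?thesis by (simp add: mem_ideal_iff)
    qed
    \<comment> \<open>A product of distinct classes of variables is lifted to a product of variables with distinct
      representatives. For an infinite set \<open>finprod\<close> is \<open>1\<close> by convention.\<close>
    have prods: "\<exists>A'. finite A' \<and> A' \<subseteq> C \<and> inj_on q A' \<and> (\<forall>c\<in>A'. h (pvar c) \<in> A) \<and>
      (\<Prod>c\<in>A'. pvar c) \<in> carrier R \<and> finprod B (\<lambda>y. y) A = h (\<Prod>c\<in>A'. pvar c)" if "A \<subseteq> Y" for A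
      using that
    proof (induction A rule: infinite_finite_induct)
      case (infinite A)
      then show ?case using R.one_closed h_one by (intro exI[of _ "{}"]) (simp add: finprod_def)
    next
      case empty
      then show ?case using R.one_closed h_one by (intro exI[of _ "{}"]) simp
    next
      case (insert y A)
      then obtain A' where A': "finite A'" "A' \<subseteq> C" "inj_on q A'" "\<forall>c\<in>A'. h (pvar c) \<in> A"
        "(\<Prod>c\<in>A'. pvar c) \<in> carrier R" "finprod B (\<lambda>y. y) A = h (\<Prod>c\<in>A'. pvar c)" by blast
      obtain c where c: "c \<in> C" "y = h (pvar c)" using insert.prems by (auto simp: Y_def)
      have new: "q c \<notin> q ` A'"
      proof
        assume "q c \<in> q ` A'"
        then obtain d where "d \<in> A'" "q c = q d" by blast
        then have "h (pvar c) = h (pvar d)" using h_var rep_eq_iff c A'(2) by blast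
        then show False using A'(4) insert.hyps(2) c(2) \<open>d \<in> A'\<close> by simp
      qed
      then have cA': "c \<notin> A'" by blast
      have "(\<lambda>y. y) \<in> A \<rightarrow> carrier B"
        using insert.prems h_carrier[OF pvar_carrier] by (force simp: Y_def)
      then have "finprod B (\<lambda>y. y) (insert y A) = h (pvar c * (\<Prod>c\<in>A'. pvar c))"
        using insert.hyps c A' by (simp add: h_carrier pvar_carrier h_mult)
      moreover have "pvar c * (\<Prod>c\<in>A'. pvar c) \<in> carrier R"
        using c A'(5) by (simp add: poly_ring_closed(2) pvar_carrier)
      ultimately show ?case
        using A' c new cA' by (intro exI[of _ "insert c A'"]) auto
    qed
    have M_carrier: "M \<subseteq> carrier B"
    proof
      fix m assume "m \<in> M"
      then obtain A where "A \<subseteq> Y" "m = finprod B (\<lambda>y. y) A" using M(1) by blast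
      then show "m \<in> carrier B" using prods[of A] h_carrier by auto
    qed
    have "M \<subseteq> h ` K"
    proof
      fix m assume m: "m \<in> M"
      then obtain A where A: "A \<subseteq> Y" "m = finprod B (\<lambda>y. y) A" using M(1) by blast
      obtain A' where A': "finite A'" "A' \<subseteq> C" "inj_on q A'" "(\<Prod>c\<in>A'. pvar c) \<in> carrier R"
        "m = h (\<Prod>c\<in>A'. pvar c)" using prods[OF A(1)] A(2) by blast
      let ?n = "\<Sum>c\<in>A'. Poly_Mapping.single (q c) (1::nat)"
      have "m \<in> h ` I" using M(2) B.genideal_self[OF M_carrier] m by blast
      then obtain g where g: "g \<in> I" "m = h g" by blast
      then have "var_subst q (\<Prod>c\<in>A'. pvar c) = var_subst q g"
        using h_eq A'(4,5) edge_ideal_carrier by blast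
      moreover have "var_subst q (\<Prod>c\<in>A'. pvar c) = (Poly_Mapping.single ?n 1 :: ('x, 'k) mpoly)"
        using A'(1) by (induction A') (simp_all add: var_subst_mult pvar_def mult_single)
      ultimately have "var_subst q g = Poly_Mapping.single ?n 1" by simp
      then have "Poly_Mapping.keys (var_subst q g) = {?n}" by simp
      then have "?n \<in> edge_mons F'" using I_keys[OF g(1)] by blast
      then obtain u v n' where n: "?n = Poly_Mapping.single u 1 + Poly_Mapping.single v 1 + n'"
        unfolding edge_mons_def by blast
      have le: "Poly_Mapping.lookup ?n w \<le> 1" for w
      proof -
        have "Poly_Mapping.lookup ?n w = card {c \<in> A'. q c = w}"
          using A'(1) by (simp add: lookup_sum lookup_single when_def sum.If_cases Int_def)
        also have "\<dots> \<le> 1"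
          using A'(1,3) by (auto simp: card_le_Suc0_iff_eq inj_on_def)
        finally show ?thesis .
      qed
      have "u \<noteq> v" using le[of u] unfolding n by (auto simp: lookup_add)
      then have "?n \<in> N"
        unfolding N_def n by (intro CollectI exI[of _ u] exI[of _ v]) (simp add: lookup_add)
      then have "(\<Prod>c\<in>A'. pvar c) \<in> K"
        using A'(4) \<open>var_subst q (\<Prod>c\<in>A'. pvar c) = Poly_Mapping.single ?n 1\<close> by (simp add: K_def)
      then show "m \<in> h ` K" using A'(5) by blast
    qed
    then have sub: "Idl\<^bsub>B\<^esub> M \<subseteq> h ` K"
      using R.ring_ideal_imp_quot_ideal[OF L K] B.genideal_minimal[of "h ` K" M]
      by (simp add: h_def B_def)
    show "\<forall>(a, b) \<in> F. \<not> ident a b"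
    proof safe
      fix a b assume ab: "(a, b) \<in> F" "ident a b"
      then have C: "a \<in> C" "b \<in> C" using F by auto
      have "h (pvar a * pvar b) \<in> h ` K" using gens_ideal[OF ab(1)] M(2) sub by blast
      then obtain g where g: "g \<in> K" "h (pvar a * pvar b) = h g" by blast
      then have "var_subst q (pvar a * pvar b) = var_subst q g"
        using h_eq[of "pvar a * pvar b" g] C by (simp add: K_def poly_ring_closed(2) pvar_carrier)
      then have "Poly_Mapping.keys (var_subst q (pvar a * pvar b) :: ('x, 'k) mpoly) \<subseteq> N"
        using g(1) by (simp add: K_def)
      then have "Poly_Mapping.single (q a) 1 + Poly_Mapping.single (q b) 1 \<in> N"
        by (simp add: var_subst_mult pvar_def mult_single mon_subst_add)
      moreover have "q a = q b" using rep_eq_iff C ab(2) by blast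
      ultimately show False
        by (auto simp: N_def lookup_add lookup_single when_def split: if_splits)
    qed
  qed
qed

end

text \<open>Both conditions refer to the span of the whole sequence, so they hold for every initial
  segment and do not depend on the order.\<close>

lemma regular_sequenceI:
  fixes fs :: "('x, 'k::field) mpoly list"
  assumes F: "F \<subseteq> C \<times> C" "sym F" and fs: "set fs \<subseteq> variable_differences C" "distinct fs"
    "lin.independent (set fs)"
    and noloop: "\<And>a b. (a, b) \<in> F \<Longrightarrow> pvar a - pvar b \<notin> lin.span (set fs)"
    and nbr: "\<And>a b c d. a \<noteq> b \<Longrightarrow> pvar a - pvar b \<in> lin.span (set fs) \<Longrightarrow>
      (a, c) \<in> F \<Longrightarrow> (b, d) \<in> F \<Longrightarrow> (c, d) \<in> F"
  shows "regular_sequence (poly_ring C) (edge_ideal C F) fs"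
proof -
  interpret fs: var_ident C F "set fs" by unfold_locales (use F fs in auto)
  show ?thesis
    unfolding regular_sequence_def Let_def
  proof (intro conjI allI impI)
    show "set fs \<subseteq> carrier (poly_ring C)" by (rule fs.D_carrier)
    show "Idl\<^bsub>poly_ring C\<^esub> (edge_ideal C F \<union> set fs) \<noteq> carrier (poly_ring C)" by (rule fs.J_proper)
    fix i assume i: "i < length fs"
    have sub: "set (take i fs) \<subseteq> set fs - {fs ! i}"
      using set_take_subset[of i fs] fs(2) i by (auto simp: in_set_conv_nth nth_eq_iff_index_eq)
    interpret var_ident C F "set (take i fs)" by unfold_locales (use F fs sub in auto)
    have span: "lin.span (set (take i fs)) \<subseteq> lin.span (set fs)"
      by (rule lin.span_mono) (use sub in auto)
    have fi: "fs ! i \<notin> lin.span (set (take i fs))"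
      using fs(3) i lin.span_mono[OF sub] unfolding lin.dependent_def by (meson nth_mem subsetD)
    obtain a b where ab: "fs ! i = pvar a - pvar b" "a \<in> C" "b \<in> C"
      using fs(1) nth_mem[OF i] by (auto simp: variable_differences_def)
    have "pvar a - pvar b \<in> lin.span (set fs)" using ab(1) lin.span_base[OF nth_mem[OF i]] by simp
    show "nonzerodivisor (R Quot J) (J +>\<^bsub>R\<^esub> (fs ! i))"
      unfolding ab(1)
    proof (rule ident_nonzerodivisor[OF assms(2) _ ab(2,3)])
      show "\<not> ident a b" using fi ab(1) by simp
      show "\<not> ident c d" if "(c, d) \<in> F" for c d using noloop that span by blast
      show "(c, d) \<in> F" if "ident a' a" "ident b' b" "(a', c) \<in> F" "(b', d) \<in> F" for a' b' c d
      proof (rule nbr[OF _ _ that(3,4)])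
        show "a' \<noteq> b'" using that(1,2) \<open>\<not> ident a b\<close> ident_sym ident_trans by blast
        show "pvar a' - pvar b' \<in> lin.span (set fs)"
          using that(1,2) span \<open>pvar a - pvar b \<in> lin.span (set fs)\<close> fs.ident_sym fs.ident_trans
          by blast
      qed
    qed
  qed
qed

lemma regular_sequenceD:
  fixes fs :: "('x, 'k::field) mpoly list"
  assumes F: "F \<subseteq> C \<times> C" "sym F" and fs: "set fs \<subseteq> variable_differences C"
    and reg: "regular_sequence (poly_ring C) (edge_ideal C F) fs"
    and i: "i < length fs" "fs ! i = pvar a0 - pvar b0" "a0 \<in> C" "b0 \<in> C"
    and ab: "pvar a - pvar a0 \<in> lin.span (set (take i fs))" "pvar b - pvar b0 \<in> lin.span (set (take i fs))"
      "(a, c) \<in> F" "(b, d) \<in> F"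
  shows "\<exists>c' d'. (c', d') \<in> F \<and> pvar c' - pvar c \<in> lin.span (set (take i fs)) \<and>
    pvar d' - pvar d \<in> lin.span (set (take i fs))"
proof -
  interpret var_ident C F "set (take i fs)"
    by unfold_locales (use F fs set_take_subset[of i fs] in auto)
  have "nonzerodivisor (R Quot J) (J +>\<^bsub>R\<^esub> (fs ! i))"
    using reg i(1) by (simp add: regular_sequence_def Let_def)
  then show ?thesis using ident_nonzerodivisorD[OF assms(2) i(3,4)] ab by (simp add: i(2))
qed

text \<open>Adjoining one identification merges two classes and changes nothing else.\<close>

lemma span_insert_merges:
  fixes D :: "('x, 'k::field) mpoly set"
  assumes D: "D \<subseteq> variable_differences C" and C: "a \<in> C" "b \<in> C" "a0 \<in> C" "b0 \<in> C"
    and ab: "pvar a - pvar b \<in> lin.span (insert (pvar a0 - pvar b0) D)"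
  shows "pvar a - pvar b \<in> lin.span D \<or>
    pvar a - pvar a0 \<in> lin.span D \<and> pvar b - pvar b0 \<in> lin.span D \<or>
    pvar a - pvar b0 \<in> lin.span D \<and> pvar b - pvar a0 \<in> lin.span D"
proof -
  interpret var_ident C "{}" D by unfold_locales (use D in auto)
  obtain t where "pvar a - pvar b - poly_scale t (pvar a0 - pvar b0) \<in> lin.span D"
    using ab lin.span_breakdown_eq by blast
  from subst_diff[OF this]
  have e: "pvar (q a) - pvar (q b) = poly_scale t (pvar (q a0) - pvar (q b0))"
    by (simp add: var_subst_diff var_subst_mult poly_scale_def)
  have coeff: "Poly_Mapping.lookup (pvar u :: ('x, 'k) mpoly) (Poly_Mapping.single x 1) = (if u = x then 1 else 0)" for u x
  proof -
    have "Poly_Mapping.single u (1::nat) = Poly_Mapping.single x 1 \<longleftrightarrow> u = x"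
      using lookup_single[of u "1::nat" x] lookup_single[of x "1::nat" x] by (auto simp: when_def split: if_splits)
    then show ?thesis by (simp add: pvar_def lookup_single when_def)
  qed
  have scale: "Poly_Mapping.lookup (poly_scale t f) m = t * Poly_Mapping.lookup f m" for f :: "('x, 'k) mpoly" and m
    unfolding poly_scale_def mult_map_scale_conv_mult[symmetric] by (simp add: map.rep_eq when_def)
  have l: "(if q a = x then 1 else 0) - (if q b = x then 1 else 0) =
    t * ((if q a0 = x then 1 else 0) - (if q b0 = x then 1 else 0))" for x
    using arg_cong[OF e, of "\<lambda>f. Poly_Mapping.lookup f (Poly_Mapping.single x 1)"]
    by (simp only: lookup_minus coeff scale)
  have "q a = q b \<or> q a = q a0 \<and> q b = q b0 \<or> q a = q b0 \<and> q b = q a0"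
    using l[of "q a"] l[of "q b"] by (auto split: if_splits)
  then show ?thesis using rep_eq_iff C by blast
qed

text \<open>For a partial equivalence relation, the span of the differences of related variables contains no
  further differences of variables that occur in the relation.\<close>

lemma difference_in_span_iff:
  fixes r :: "'x \<Rightarrow> 'x \<Rightarrow> bool"
  assumes "symp r" "transp r" "r a a" "r b b"
  shows "(pvar a - pvar b :: ('x, 'k::field) mpoly) \<in> lin.span {pvar a - pvar b | a b. r a b} \<longleftrightarrow> r a b"
proof
  define p where "p c = (SOME d. r c d)" for c
  have p: "p c = p d" if "r c d" for c d
  proof -
    have "r c x \<longleftrightarrow> r d x" for x using that assms(1,2) by (meson sympD transpD)
    then have "r c = r d" by blast
    then show ?thesis unfolding p_def by simp
  qed
  have "lin.span {pvar a - pvar b | a b. r a b} \<subseteq> {d :: ('x, 'k) mpoly. var_subst p d = 0}"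
  proof (rule lin.span_minimal)
    show "{pvar a - pvar b | a b. r a b} \<subseteq> {d :: ('x, 'k) mpoly. var_subst p d = 0}"
      using p by (auto simp: var_subst_diff)
    show "lin.subspace {d :: ('x, 'k) mpoly. var_subst p d = 0}"
      by (rule lin.subspaceI) (simp_all add: var_subst_add var_subst_mult poly_scale_def)
  qed
  moreover assume "(pvar a - pvar b :: ('x, 'k) mpoly) \<in> lin.span {pvar a - pvar b | a b. r a b}"
  ultimately have "var_subst p (pvar a - pvar b :: ('x, 'k) mpoly) = 0" by blast
  then have "p a = p b" by (simp add: var_subst_diff pvar_eq_iff)
  moreover have "r a (p a)" unfolding p_def using assms(3) by (rule someI)
  moreover have "r b (p b)" unfolding p_def using assms(4) by (rule someI)
  ultimately show "r a b" using assms(1,2) by (metis sympD transpD)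
next
  assume "r a b"
  then show "(pvar a - pvar b :: ('x, 'k) mpoly) \<in> lin.span {pvar a - pvar b | a b. r a b}"
    by (auto intro!: lin.span_base)
qed

lemma differences_basis:
  fixes r :: "'x \<Rightarrow> 'x \<Rightarrow> bool"
  assumes "finite C" and rC: "{(a, b). r a b} \<subseteq> C \<times> C"
  defines "L \<equiv> lin.span {pvar a - pvar b | a b. r a b} :: ('x, 'k::field) mpoly set"
  shows "\<exists>fs. set fs \<subseteq> variable_differences C \<and> distinct fs \<and> lin.independent (set fs) \<and>
      lin.span (set fs) = L"
    and "L \<subseteq> lin.span (pvar ` C)"
proof -
  have r: "a \<in> C \<and> b \<in> C" if "r a b" for a b using rC that by blast
  let ?A = "{pvar a - pvar b | a b. r a b} :: ('x, 'k) mpoly set"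
  let ?D = "?A - {0}"
  have LD: "L = lin.span ?D" by (simp add: L_def)
  have vd: "?D \<subseteq> variable_differences C"
    using r by (auto simp: variable_differences_def) (metis diff_self)
  have "?D \<subseteq> (\<lambda>(a, b). pvar a - pvar b) ` (C \<times> C)"
    using r by fastforce
  then have fin_D: "finite ?D" by (rule finite_subset) (use \<open>finite C\<close> in simp)
  obtain B where B: "B \<subseteq> ?D" "lin.independent B" "?D \<subseteq> lin.span B"
    using lin.maximal_independent_subset[of ?D] by blast
  obtain fs where fs: "set fs = B" "distinct fs"
    using finite_distinct_list[OF finite_subset[OF B(1) fin_D]] by blast
  have "lin.span (set fs) = L"
    unfolding LD fs(1)
    by (rule antisym) (rule lin.span_mono[OF B(1)], rule lin.span_minimal[OF B(3) lin.subspace_span])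
  moreover have "set fs \<subseteq> variable_differences C" using fs(1) B(1) vd by simp
  ultimately show "\<exists>fs. set fs \<subseteq> variable_differences C \<and> distinct fs \<and> lin.independent (set fs) \<and>
      lin.span (set fs) = L"
    using fs B(2) by blast
  have "?A \<subseteq> lin.span (pvar ` C)"
  proof (rule subsetI)
    fix d assume "d \<in> ?A"
    then obtain a b where "d = pvar a - pvar b" "a \<in> C" "b \<in> C" using r by auto
    then show "d \<in> lin.span (pvar ` C)" by (simp add: lin.span_diff lin.span_base)
  qed
  then show "L \<subseteq> lin.span (pvar ` C)" unfolding L_def by (rule lin.span_minimal) simp
qed

section \<open>Identifications coming from a partition\<close>

context ftree
begin

text \<open>The graph on the variables whose edge ideal is the tree ideal.\<close>

definition facing_pairs :: "(('v set \<times> 'v) \<times> ('v set \<times> 'v)) set" where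
  "facing_pairs = {(arrow y v, arrow z w) | y v z w. facing y v z w}"

lemma facing_pairs_arrow: "(arrow y v, arrow z w) \<in> facing_pairs \<longleftrightarrow> facing y v z w"
  by (auto simp: facing_pairs_def)

lemma facing_pairsE:
  assumes "(a, b) \<in> facing_pairs"
  obtains y v z w where "a = arrow y v" "b = arrow z w" "facing y v z w"
  using assms by (auto simp: facing_pairs_def)

lemma facing_pairs_incidence: "facing_pairs \<subseteq> incidence V E \<times> incidence V E"
  by (auto simp: facing_pairs_def incidence_arrow facing_def)

lemma facing_pairs_sym: "sym facing_pairs"
  using facing_commute by (auto simp: facing_pairs_def intro!: symI)

lemma tree_ideal_eq:
  "(tree_ideal V E :: ('v set \<times> 'v, 'k::field) mpoly set) = edge_ideal (incidence V E) facing_pairs"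
proof -
  have "{tree_monomial V E v w :: ('v set \<times> 'v, 'k) mpoly | v w. v \<in> V \<and> w \<in> V \<and> v \<noteq> w} =
    {pvar a * pvar b | a b. (a, b) \<in> facing_pairs}"
    unfolding facing_pairs_def tree_monomial_arrow facing_iff by blast
  then show ?thesis unfolding tree_ideal_def edge_ideal_def by (simp only:)
qed

text \<open>The identifications prescribed by a partition. They form an equivalence relation on the arrows if
  the blocks are independent.\<close>

definition partition_rel :: "'v set set \<Rightarrow> 'v set \<times> 'v \<Rightarrow> 'v set \<times> 'v \<Rightarrow> bool" where
  "partition_rel Q a b \<longleftrightarrow> (\<exists>U\<in>Q. block_rel U a b)"

lemma partition_rel_incidence: "partition_rel Q a b \<Longrightarrow> a \<in> incidence V E \<and> b \<in> incidence V E"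
  by (auto simp: partition_rel_def block_rel_def incidence_arrow)

lemma partition_rel_sym: "partition_rel Q a b \<Longrightarrow> partition_rel Q b a"
  unfolding partition_rel_def using block_rel_sym by blast

lemma partition_rel_trans:
  assumes "partition_on V Q" "partition_rel Q a b" "partition_rel Q b c"
  shows "partition_rel Q a c"
proof -
  obtain U W where U: "U \<in> Q" "block_rel U a b" and W: "W \<in> Q" "block_rel W b c"
    using assms(2,3) by (auto simp: partition_rel_def)
  then have "U \<inter> W \<noteq> {}" by (auto simp: block_rel_def)
  then have "U = W" using U(1) W(1) assms(1) by (auto simp: partition_on_def pairwise_def disjnt_def)
  then show ?thesis using U W block_rel_trans unfolding partition_rel_def by blast
qed

lemma partition_rel_refl:
  assumes "partition_on V Q" "\<forall>U\<in>Q. independent_set E U" "a \<in> incidence V E"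
  shows "partition_rel Q a a"
proof -
  obtain y v where a: "a = arrow y v" "{y, v} \<in> E" using assms(3) by (auto simp: incidence_arrow)
  note V = edge_in[OF a(2)]
  then obtain U where U: "U \<in> Q" "v \<in> U" using assms(1) by (auto simp: partition_on_def)
  then have "y \<notin> U" using assms(2) U(1) a(2) by (auto simp: independent_set_def)
  then have "block_rel U a a" using a V U by (simp add: block_rel_arrow seg_self)
  then show ?thesis using U by (auto simp: partition_rel_def)
qed

lemma L_partition_eq:
  assumes "partition_on V Q" "\<forall>U\<in>Q. independent_set E U"
  shows "(L_partition V E Q :: ('v set \<times> 'v, 'k::field) mpoly set) =
    lin.span {pvar a - pvar b | a b. partition_rel Q a b}" (is "_ = lin.span ?D")
proof -
  let ?D' = "\<lambda>U. {pvar a - pvar b | a b. block_rel U a b} :: ('v set \<times> 'v, 'k::field) mpoly set"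
  have L: "(L_set V E U :: ('v set \<times> 'v, 'k) mpoly set) = lin.span (?D' U)" if "U \<in> Q" for U
    using that assms by (intro L_set_eq) (auto simp: partition_on_def)
  have D: "?D' U \<subseteq> ?D" if "U \<in> Q" for U using that unfolding partition_rel_def by blast
  show ?thesis
    unfolding L_partition_def
  proof (rule antisym; rule lin.span_minimal)
    show "(\<Union>U\<in>Q. L_set V E U) \<subseteq> lin.span ?D" using L lin.span_mono[OF D] by blast
    show "?D \<subseteq> lin.span (\<Union>U\<in>Q. L_set V E U)"
    proof safe
      fix a b assume "partition_rel Q a b"
      then obtain U where "U \<in> Q" "block_rel U a b" by (auto simp: partition_rel_def)
      then have "pvar a - pvar b \<in> lin.span (?D' U)" by (intro lin.span_base) blast
      then have "(pvar a - pvar b :: ('v set \<times> 'v, 'k) mpoly) \<in> L_set V E U"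
        unfolding L[OF \<open>U \<in> Q\<close>] .
      then show "(pvar a - pvar b :: ('v set \<times> 'v, 'k) mpoly) \<in> lin.span (\<Union>U\<in>Q. L_set V E U)"
        using \<open>U \<in> Q\<close> by (intro lin.span_base UN_I)
    qed
  qed simp_all
qed

lemma difference_in_L_partition_iff:
  assumes "partition_on V Q" "\<forall>U\<in>Q. independent_set E U"
    and "a \<in> incidence V E" "b \<in> incidence V E"
  shows "(pvar a - pvar b :: ('v set \<times> 'v, 'k::field) mpoly) \<in> L_partition V E Q \<longleftrightarrow> partition_rel Q a b"
  unfolding L_partition_eq[OF assms(1,2)]
proof (rule difference_in_span_iff)
  show "symp (partition_rel Q)" by (rule sympI) (rule partition_rel_sym)
  show "transp (partition_rel Q)" by (rule transpI) (rule partition_rel_trans[OF assms(1)])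
  show "partition_rel Q a a" "partition_rel Q b b"
    using partition_rel_refl[OF assms(1,2)] assms(3,4) by simp_all
qed

lemma L_partition_regular_squarefree:
  assumes Q: "partition_on V Q" "\<forall>U\<in>Q. independent_set E U"
  defines "L \<equiv> L_partition V E Q :: ('v set \<times> 'v, 'k::field) mpoly set"
  shows "regular_linear_space (incidence V E) (tree_ideal V E) L"
    "squarefree_quotient (incidence V E) (tree_ideal V E) L"
proof -
  let ?C = "incidence V E"
  have L: "L = lin.span {pvar a - pvar b | a b. partition_rel Q a b}"
    unfolding L_def by (rule L_partition_eq[OF Q])
  have fin_C: "finite ?C"
    by (rule finite_subset[of _ "Pow V \<times> V"]) (use edge_card finite_V in \<open>auto simp: incidence_def\<close>)
  have rel_C: "{(a, b). partition_rel Q a b} \<subseteq> ?C \<times> ?C" using partition_rel_incidence by blast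
  obtain fs :: "('v set \<times> 'v, 'k) mpoly list" where fs_vd: "set fs \<subseteq> variable_differences ?C"
    and fs: "distinct fs" "lin.independent (set fs)" and span: "lin.span (set fs) = L"
    using differences_basis(1)[OF fin_C rel_C] unfolding L by blast
  have L_sub: "L \<subseteq> lin.span (pvar ` ?C)"
    unfolding L by (rule differences_basis(2)[OF fin_C rel_C])
  have iff: "(pvar a - pvar b :: ('v set \<times> 'v, 'k) mpoly) \<in> L \<longleftrightarrow> partition_rel Q a b"
    if "a \<in> ?C" "b \<in> ?C" for a b
    unfolding L_def by (rule difference_in_L_partition_iff[OF Q that])
  have noloop: "(pvar a - pvar b :: ('v set \<times> 'v, 'k) mpoly) \<notin> L" if ab: "(a, b) \<in> facing_pairs" for a b
  proof -
    obtain y v z w where e: "a = arrow y v" "b = arrow z w" "facing y v z w"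
      using ab by (rule facing_pairsE)
    then have "\<not> partition_rel Q a b" using block_rel_outward(1) by (auto simp: partition_rel_def)
    then show ?thesis using iff ab facing_pairs_incidence by blast
  qed
  have "regular_sequence (poly_ring ?C) (edge_ideal ?C facing_pairs) fs"
  proof (rule regular_sequenceI[OF facing_pairs_incidence facing_pairs_sym fs_vd fs])
    show "pvar a - pvar b \<notin> lin.span (set fs)" if "(a, b) \<in> facing_pairs" for a b
      using noloop[OF that] span by simp
    show "(c, d) \<in> facing_pairs"
      if h: "a \<noteq> b" "pvar a - pvar b \<in> lin.span (set fs)" "(a, c) \<in> facing_pairs" "(b, d) \<in> facing_pairs" for a b c d
    proof -
      have "a \<in> ?C" "b \<in> ?C" using h facing_pairs_incidence by blast+
      then have "partition_rel Q a b" using h(2) iff[of a b] unfolding span by blast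
      then obtain U where r: "block_rel U a b" by (auto simp: partition_rel_def)
      obtain y v y1 v1 where e1: "a = arrow y v" "c = arrow y1 v1" "facing y v y1 v1"
        using h(3) by (rule facing_pairsE)
      obtain z w z1 w1 where e2: "b = arrow z w" "d = arrow z1 w1" "facing z w z1 w1"
        using h(4) by (rule facing_pairsE)
      have "outward y v z w" using block_rel_outward(2)[of U y v z w] r e1 e2 h(1) by auto
      then show ?thesis
        unfolding e1(2) e2(2) facing_pairs_arrow using e1(3) e2(3) by (rule outward_neighbours_facing)
    qed
  qed
  moreover have "lin.subspace L" unfolding L by (rule lin.subspace_span)
  ultimately show "regular_linear_space ?C (tree_ideal V E) L"
    using fs fs_vd span L_sub unfolding regular_linear_space_def tree_ideal_eq
    by (intro conjI exI[of _ fs]) simp_all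
  interpret var_ident ?C facing_pairs "set fs"
    by unfold_locales (use facing_pairs_incidence fs_vd in auto)
  have "squarefree_quotient ?C I (lin.span (set fs))"
    unfolding squarefree_quotient_iff unfolding span using noloop by blast
  then show "squarefree_quotient ?C (tree_ideal V E) L"
    unfolding span tree_ideal_eq .
qed

section \<open>Every regular linear space comes from a partition\<close>

text \<open>Two vertices are linked if they are heads of equivalent arrows. Along a chain of links from \<open>v\<close>
  to \<open>w\<close>, two consecutive links that meet in the same arrow can be replaced by one; a chain without
  such shortcuts follows the path from \<open>v\<close> to \<open>w\<close>. Only its first link is recorded: it joins \<open>v\<close> to
  a vertex \<open>v1\<close> on this path, from which \<open>w\<close> is reached in fewer steps.\<close>

lemma chain_first_step:
  fixes R :: "('v set \<times> 'v) \<Rightarrow> ('v set \<times> 'v) \<Rightarrow> bool"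
  assumes R: "symp R" "transp R"
    and out: "\<And>y v z w. R (arrow y v) (arrow z w) \<Longrightarrow> arrow y v = arrow z w \<or> outward y v z w"
  defines "H \<equiv> {(v, w). \<exists>y z. R (arrow y v) (arrow z w)}"
  shows "(v, w) \<in> H ^^ n \<Longrightarrow> v \<in> V \<Longrightarrow> w \<in> V \<Longrightarrow> v \<noteq> w \<Longrightarrow>
    \<exists>v1 m. m < n \<and> R (arrow (step v w) v) (arrow (step v1 v) v1) \<and> v1 \<in> seg v w \<and> v1 \<noteq> v \<and>
      v1 \<in> V \<and> (v1, w) \<in> H ^^ m"
proof (induction n arbitrary: v w rule: less_induct)
  case (less n)
  obtain k where n: "n = Suc k" using less.prems(1,4) by (cases n) auto
  obtain u where u: "(v, u) \<in> H" "(u, w) \<in> H ^^ k" using less.prems(1) n relpow_Suc_D2 by metis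
  show ?case
  proof (cases "v = u")
    case True
    then show ?thesis using less.IH[of k v w] u(2) less.prems n by (auto intro: less_SucI)
  next
    case False
    obtain y x where r: "R (arrow y v) (arrow x u)" using u(1) by (auto simp: H_def)
    then have "outward y v x u" using out[OF r] False by auto
    then have x: "u \<in> V" "y = step v u" "x = step u v" using False by (auto simp: facing_iff)
    show ?thesis
    proof (cases "u = w")
      case True
      then show ?thesis using r x False u(2) n seg_ends[of v w] less.prems by blast
    next
      case uw: False
      obtain v2 m where v2: "m < k" "R (arrow (step u w) u) (arrow (step v2 u) v2)"
        "v2 \<in> seg u w" "(v2, w) \<in> H ^^ m"
        using less.IH[of k u w] n u(2) x(1) less.prems(3) uw by blast
      show ?thesis
      proof (cases "x = step u w")
        case True
        then have "R (arrow y v) (arrow (step v2 u) v2)" using r v2(2) R(2) by (meson transpE)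
        then have "(v, v2) \<in> H" by (auto simp: H_def)
        then have "(v, w) \<in> H ^^ Suc m" using v2(4) by (rule relpow_Suc_I2)
        from less.IH[OF _ this less.prems(2-4)] v2(1) n show ?thesis
          by (meson Suc_mono less_trans)
      next
        case F: False
        have st: "{u, x} \<in> E" "u \<notin> seg x v" "{u, step u w} \<in> E" "u \<notin> seg (step u w) w"
          using step_to[of u v] step_to[of u w] x less.prems uw False by auto
        note V = edge_in[OF st(1)] edge_in[OF st(3)]
        have "u \<in> seg x (step u w)" by (rule seg_neighbours) (use st F in auto)
        then have uvw: "u \<in> seg v w"
          using seg_avoid[of u x v w] seg_avoid[of u x w "step u w"] seg_commute[of "step u w" w]
             V st less.prems seg_triangle[of x "step u w" w] by blast
        have "y = step v w"
        proof -
          have y: "{v, y} \<in> E" "v \<notin> seg y u" using step_to[of v u] x less.prems False by auto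
          have "v \<notin> seg u w" using seg_antisym[of v w u] uvw less.prems x False by blast
          then have "v \<notin> seg y w" using seg_avoid[of v y u w] y edge_in[OF y(1)] x less.prems by blast
          then show ?thesis using step_unique[OF y(1)] less.prems by simp
        qed
        then show ?thesis using r x uvw False u(2) n by blast
      qed
    qed
  qed
qed

text \<open>An equivalence relation on the arrows under which distinct equivalent arrows are outward and
  facing arrows are never equivalent comes from a partition into independent sets. The blocks are the
  sets of vertices connected by chains of links.\<close>

lemma partition_of_relation:
  fixes R :: "('v set \<times> 'v) \<Rightarrow> ('v set \<times> 'v) \<Rightarrow> bool"
  assumes R: "symp R" "transp R" and C: "\<And>a b. R a b \<Longrightarrow> a \<in> incidence V E \<and> b \<in> incidence V E"
    and refl: "\<And>a. a \<in> incidence V E \<Longrightarrow> R a a"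
    and noloop: "\<And>y v z w. R (arrow y v) (arrow z w) \<Longrightarrow> \<not> facing y v z w"
    and out: "\<And>y v z w. R (arrow y v) (arrow z w) \<Longrightarrow> arrow y v = arrow z w \<or> outward y v z w"
  shows "\<exists>Q. partition_on V Q \<and> (\<forall>U\<in>Q. independent_set E U) \<and> (\<forall>a b. partition_rel Q a b \<longleftrightarrow> R a b)"
proof -
  define H where "H = {(v, w). \<exists>y z. R (arrow y v) (arrow z w)}"
  define r where "r = {(v, w). v \<in> V \<and> w \<in> V \<and> (v, w) \<in> H\<^sup>*}"
  define Q where "Q = V // r"
  have H_edges: "R (arrow y v) (arrow z w) \<Longrightarrow> {y, v} \<in> E \<and> {z, w} \<in> E" for y v z w
    using C[of "arrow y v" "arrow z w"] by (auto simp: incidence_arrow)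
  have "sym H" using R(1) by (auto simp: H_def sym_def dest: sympD)
  then have symH: "sym (H\<^sup>*)" by (rule sym_rtrancl)
  have r: "equiv V r"
    by (rule equivI) (use symH in \<open>auto simp: r_def refl_on_def sym_def trans_def\<close>)
  have Q: "partition_on V Q" unfolding Q_def by (rule partition_on_quotient[OF r])
  have block: "w \<in> U \<longleftrightarrow> (v, w) \<in> r" if "U \<in> Q" "v \<in> U" for U v w
    using that r unfolding Q_def by (meson quotient_eq_iff quotientE Image_singleton_iff equiv_class_eq_iff in_quotient_imp_closed in_quotient_imp_in_rel)
  have chain: "\<exists>v1. R (arrow (step v w) v) (arrow (step v1 v) v1) \<and> v1 \<in> seg v w \<and> v1 \<noteq> v \<and> (v, v1) \<in> r"
    if vwr: "(v, w) \<in> r" "v \<noteq> w" for v w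
  proof -
    have V: "v \<in> V" "w \<in> V" and vw: "(v, w) \<in> H\<^sup>*" using that(1) by (auto simp: r_def)
    obtain n where n: "(v, w) \<in> H ^^ n" using rtrancl_imp_relpow[OF vw] by blast
    obtain v1 where v1: "R (arrow (step v w) v) (arrow (step v1 v) v1)" "v1 \<in> seg v w" "v1 \<noteq> v" "v1 \<in> V"
      using chain_first_step[of R v w n, folded H_def] R out n V vwr(2) by blast
    then have "(v, v1) \<in> H" by (auto simp: H_def)
    then show ?thesis using v1 V by (auto simp: r_def)
  qed
  have indep: "{v, w} \<notin> E" if vwr: "(v, w) \<in> r" for v w
  proof
    assume E: "{v, w} \<in> E"
    then have "v \<noteq> w" using edge_in by blast
    then obtain v1 where v1: "R (arrow (step v w) v) (arrow (step v1 v) v1)" "v1 \<in> seg v w" "v1 \<noteq> v"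
      using chain[OF vwr] by blast
    have "v1 = w" using v1 seg_edge[OF E] by auto
    have E': "{w, v} \<in> E" using E by (simp add: insert_commute)
    have "step v w = w" "step w v = v"
      using step_unique[OF E] step_unique[OF E'] seg_self edge_in[OF E] by auto
    then have "R (arrow w v) (arrow v w)" using v1 \<open>v1 = w\<close> by simp
    then show False using noloop facing_reverse[OF E'] by blast
  qed
  have QE: "\<forall>U\<in>Q. independent_set E U"
    using indep block unfolding independent_set_def by blast
  have "R a b" if ab: "partition_rel Q a b" for a b
  proof -
    obtain U y v z w where e: "a = arrow y v" "b = arrow z w" and U: "U \<in> Q" and r1: "block_rel U (arrow y v) (arrow z w)"
      using ab by (auto simp: partition_rel_def block_rel_def)
    then have E: "{y, v} \<in> E" "{z, w} \<in> E" and vw: "v \<in> U" "w \<in> U" and yz: "seg y z \<inter> U = {}"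
      by (auto simp: block_rel_arrow)
    note V = edge_in[OF E(1)] edge_in[OF E(2)]
    show ?thesis
    proof (cases "v = w")
      case True
      then have "a = b" using block_rel_outward(2)[OF r1] e by (auto simp: facing_iff)
      then show ?thesis using refl e E by (auto simp: incidence_arrow)
    next
      case False
      obtain v1 where v1: "R (arrow (step v w) v) (arrow (step v1 v) v1)" "v1 \<in> seg v w" "v1 \<noteq> v" "(v, v1) \<in> r"
        using chain[of v w] block[OF U vw(1)] vw(2) False by blast
      have "seg v w \<subseteq> {v} \<union> seg y z \<union> {w}"
        using seg_triangle[of v w y] seg_triangle[of y w z] seg_edge[OF E(1)] seg_edge[OF E(2)]
          seg_ends[of y z] seg_commute[of v y] V by auto
      moreover have "v1 \<in> U" using v1(4) block[OF U vw(1)] by blast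
      ultimately have "v1 = w" using v1 yz by blast
      then show ?thesis using v1(1) block_rel_step[OF r1 False] e by simp
    qed
  qed
  moreover have "partition_rel Q a b" if ab: "R a b" for a b
  proof -
    obtain y v z w where e: "a = arrow y v" "b = arrow z w" and E: "{y, v} \<in> E" "{z, w} \<in> E"
      using C[OF ab] by (auto simp: incidence_arrow)
    note V = edge_in[OF E(1)] edge_in[OF E(2)]
    have Rab: "R (arrow y v) (arrow z w)" using ab e by simp
    then have "(v, w) \<in> H" by (auto simp: H_def)
    then have vw: "(v, w) \<in> r" using V by (auto simp: r_def)
    obtain U where U: "U \<in> Q" "v \<in> U" using Q V by (auto simp: partition_on_def)
    then have wU: "w \<in> U" using block vw by blast
    show ?thesis
    proof (cases "a = b")
      case True
      then show ?thesis using partition_rel_refl[OF Q QE] C[OF ab] by blast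
    next
      case False
      then have o: "outward y v z w" using out[OF Rab] e by auto
      then have o': "v \<notin> seg y w" "w \<notin> seg z v" "v \<noteq> w" "y = step v w" "z = step w v"
         using facing_iff[of v y w z] by (auto simp: facing_def)
      have "u \<notin> U" if u: "u \<in> seg y z" for u
      proof
        assume uU: "u \<in> U"
        have uV: "u \<in> V" using seg_subset u V by blast
        have "z \<in> seg w v" using edge_side[of w z v] o'(2) E(2) V by (auto simp: insert_commute)
        then have zvw: "z \<in> seg v w" using seg_commute V by blast
        have yvw: "y \<in> seg v w" using edge_side[of v y w] o'(1) E(1) V by (auto simp: insert_commute)
        have indepE: "{v, w} \<notin> E" using indep vw by blast
        have "z \<noteq> v" using indepE E(2) by auto
        have "seg v y = {v, y}" using seg_edge[of v y] E(1) by (simp add: insert_commute)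
        then have "z \<in> seg y w"
          using zvw seg_triangle[of v w y] seg_ends[of y w] V \<open>z \<noteq> v\<close> by blast
        then have uyw: "u \<in> seg y w" using seg_split(1)[of y w z] u V by blast
        then have uvw: "u \<in> seg v w" and yvu: "y \<in> seg v u"
          using seg_between[of v w y u] yvw V by blast+
        have uv: "u \<noteq> v" using uyw o'(1) by blast
        have "w \<notin> seg y z"
        proof
          assume "w \<in> seg y z"
          then have "z = w" using seg_antisym[of w y z] \<open>z \<in> seg y w\<close> seg_commute V by metis
          then show False using V by blast
        qed
        then have uw: "u \<noteq> w" using u by blast
        have "(v, u) \<in> r" using block U uU by blast
        from chain[OF this uv[symmetric]] obtain v1 where v1: "R (arrow (step v u) v) (arrow (step v1 v) v1)"
          "v1 \<in> seg v u" "v1 \<noteq> v" "(v, v1) \<in> r" by blast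
        have v1V: "v1 \<in> V" using v1(4) by (simp add: r_def)
        have v1vw: "v1 \<in> seg v w" using seg_split(1)[of v w u] uvw v1(2) V by blast
        have "step v u = y"
        proof (rule step_unique)
          show "{v, y} \<in> E" using E(1) by (simp add: insert_commute)
          then show "v \<notin> seg y u" using edge_side yvu uV by blast
        qed fact
        then have "R (arrow z w) (arrow (step v1 v) v1)" using v1(1) Rab R by (metis sympE transpE)
        from out[OF this] show False
        proof
          assume "arrow z w = arrow (step v1 v) v1"
          then have "w \<in> seg v u" using v1(2) by simp
          then show False using seg_antisym[of w v u] uvw seg_commute[of v w] seg_commute[of v u] uw V uV by simp
        next
          assume o1: "outward z w (step v1 v) v1"
          then have "v1 \<notin> seg (step v1 v) w" by (simp add: facing_def)
          moreover have "v1 \<notin> seg (step v1 v) v" "step v1 v \<in> V"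
            using step_to[of v1 v] v1V v1(3) V edge_in by blast+
          ultimately have "v1 \<notin> seg v w"
            using seg_avoid[of v1 v "step v1 v" w] seg_commute[of v "step v1 v"] V by blast
          then show False using v1vw by blast
        qed
      qed
      then have "block_rel U a b" using e E U wU by (auto simp: block_rel_arrow)
      then show ?thesis using U by (auto simp: partition_rel_def)
    qed
  qed
  ultimately show ?thesis using Q QE by blast
qed

text \<open>Along a regular sequence that never contracts a facing pair, all identified arrows are outward.
  By induction, the next element of the sequence merges two classes, and the condition for a
  nonzerodivisor holds for every pair of arrows from these classes.\<close>

lemma regular_outward:
  fixes fs :: "('v set \<times> 'v, 'k::field) mpoly list"
  assumes fs: "set fs \<subseteq> variable_differences (incidence V E)"
    and reg: "regular_sequence (poly_ring (incidence V E)) (edge_ideal (incidence V E) facing_pairs) fs"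
    and noloop: "\<And>a b. (a, b) \<in> facing_pairs \<Longrightarrow> pvar a - pvar b \<notin> lin.span (set fs)"
  shows "i \<le> length fs \<Longrightarrow> {y, v} \<in> E \<Longrightarrow> {z, w} \<in> E \<Longrightarrow>
    pvar (arrow y v) - pvar (arrow z w) \<in> lin.span (set (take i fs)) \<Longrightarrow>
    arrow y v = arrow z w \<or> outward y v z w"
proof (induction i arbitrary: y v z w)
  case 0
  then show ?case by (simp add: pvar_eq_iff)
next
  case (Suc i)
  let ?C = "incidence V E" and ?S = "lin.span (set (take i fs))"
  have i: "i < length fs" using Suc.prems(1) by simp
  interpret var_ident ?C facing_pairs "set (take i fs)"
    by unfold_locales (use facing_pairs_incidence fs set_take_subset[of i fs] in auto)
  have S: "?S \<subseteq> lin.span (set fs)" by (rule lin.span_mono) (rule set_take_subset)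
  obtain a0 b0 where a0: "fs ! i = pvar a0 - pvar b0" "a0 \<in> ?C" "b0 \<in> ?C"
    using variable_differencesE subsetD[OF fs nth_mem[OF i]] by metis
  define R where "R a b \<longleftrightarrow> a \<in> ?C \<and> b \<in> ?C \<and> pvar a - pvar b \<in> ?S" for a b
  have "symp R" unfolding R_def by (rule sympI) (use ident_sym in blast)
  moreover have "transp R" unfolding R_def by (rule transpI) (use ident_trans in blast)
  ultimately have R: "symp R" "transp R" by blast+
  have R_arrow: "R (arrow y v) (arrow z w) \<Longrightarrow> {y, v} \<in> E \<and> {z, w} \<in> E \<and>
      pvar (arrow y v) - pvar (arrow z w) \<in> ?S" for y v z w
    by (auto simp: R_def incidence_arrow)
  have merged: "outward y v z w"
    if E: "{y, v} \<in> E" "{z, w} \<in> E" and yz: "ident (arrow y v) a0" "ident (arrow z w) b0" for y v z w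
  proof (rule outward_if_neighbours_facing[OF R _ _ E])
    show "\<not> facing y v z w" if "R (arrow y v) (arrow z w)" for y v z w
      using R_arrow[OF that] noloop S facing_pairs_arrow by blast
    show "arrow y v = arrow z w \<or> outward y v z w" if "R (arrow y v) (arrow z w)" for y v z w
      using R_arrow[OF that] Suc.IH i by simp
    show "\<exists>p p' x x'. facing p p' x x' \<and> R (arrow p p') (arrow y1 v1) \<and> R (arrow x x') (arrow z1 w1)"
      if f: "facing y v y1 v1" "facing z w z1 w1" for y1 v1 z1 w1
    proof -
      have "(arrow y v, arrow y1 v1) \<in> facing_pairs" "(arrow z w, arrow z1 w1) \<in> facing_pairs"
        using f by (simp_all add: facing_pairs_arrow)
      from regular_sequenceD[OF facing_pairs_incidence facing_pairs_sym fs reg i a0 yz this]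
      obtain c d where cd: "(c, d) \<in> facing_pairs" "ident c (arrow y1 v1)" "ident d (arrow z1 w1)"
        by blast
      obtain p p' x x' where e: "c = arrow p p'" "d = arrow x x'" "facing p p' x x'"
        using cd(1) by (rule facing_pairsE)
      have "arrow y1 v1 \<in> ?C" "arrow z1 w1 \<in> ?C" "c \<in> ?C" "d \<in> ?C"
        using f e by (auto simp: incidence_arrow facing_def)
      then show ?thesis using cd e by (auto simp: R_def)
    qed
  qed
  have C: "arrow y v \<in> ?C" "arrow z w \<in> ?C" using Suc.prems by (auto simp: incidence_arrow)
  have "pvar (arrow y v) - pvar (arrow z w) \<in> lin.span (insert (pvar a0 - pvar b0) (set (take i fs)))"
    using Suc.prems(4) i by (simp add: take_Suc_conv_app_nth a0(1))
  from span_insert_merges[OF D C a0(2,3) this]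
  consider "ident (arrow y v) (arrow z w)" | "ident (arrow y v) a0" "ident (arrow z w) b0"
    | "ident (arrow y v) b0" "ident (arrow z w) a0" by blast
  then show ?case
  proof cases
    case 1
    then show ?thesis using Suc.IH Suc.prems by simp
  next
    case 2
    then show ?thesis using merged Suc.prems by blast
  next
    case 3
    then have "outward z w y v" using merged Suc.prems by blast
    then show ?thesis using facing_commute by blast
  qed
qed

lemma regular_squarefree_from_partition:
  fixes L :: "('v set \<times> 'v, 'k::field) mpoly set"
  assumes reg: "regular_linear_space (incidence V E) (tree_ideal V E) L"
    and sf: "squarefree_quotient (incidence V E) (tree_ideal V E) L"
  shows "\<exists>Q. partition_on V Q \<and> (\<forall>U\<in>Q. independent_set E U) \<and> L = L_partition V E Q"
proof -
  let ?C = "incidence V E"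
  obtain fs where fs: "lin.span (set fs) = L" "set fs \<subseteq> variable_differences ?C"
    "regular_sequence (poly_ring ?C) (edge_ideal ?C facing_pairs) fs"
    using reg unfolding regular_linear_space_def tree_ideal_eq by blast
  interpret var_ident ?C facing_pairs "set fs"
    by unfold_locales (use facing_pairs_incidence fs in auto)
  have noloop: "\<not> ident a b" if "(a, b) \<in> facing_pairs" for a b
  proof -
    have "squarefree_quotient ?C I (lin.span (set fs))" using sf unfolding tree_ideal_eq fs(1) .
    then show ?thesis unfolding squarefree_quotient_iff using that by blast
  qed
  define R where "R a b \<longleftrightarrow> a \<in> ?C \<and> b \<in> ?C \<and> ident a b" for a b
  have "\<exists>Q. partition_on V Q \<and> (\<forall>U\<in>Q. independent_set E U) \<and> (\<forall>a b. partition_rel Q a b \<longleftrightarrow> R a b)"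
  proof (rule partition_of_relation)
    show "symp R" unfolding R_def by (rule sympI) (use ident_sym in blast)
    show "transp R" unfolding R_def by (rule transpI) (use ident_trans in blast)
    show "a \<in> ?C \<and> b \<in> ?C" if "R a b" for a b using that by (simp add: R_def)
    show "R a a" if "a \<in> ?C" for a using that ident_refl by (simp add: R_def)
    show "\<not> facing y v z w" if "R (arrow y v) (arrow z w)" for y v z w
      using that noloop[of "arrow y v" "arrow z w"] by (auto simp: R_def facing_pairs_arrow)
    show "arrow y v = arrow z w \<or> outward y v z w" if "R (arrow y v) (arrow z w)" for y v z w
      using that regular_outward[OF fs(2,3) noloop, of "length fs" y v z w]
      by (auto simp: R_def incidence_arrow)
  qed
  then obtain Q where Q: "partition_on V Q" "\<forall>U\<in>Q. independent_set E U"
    and Q_rel: "\<And>a b. partition_rel Q a b \<longleftrightarrow> R a b" by blast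
  have "L_partition V E Q = lin.span {pvar a - pvar b :: ('v set \<times> 'v, 'k) mpoly | a b. R a b}"
    using L_partition_eq[OF Q] unfolding Q_rel .
  also have "\<dots> = L"
    unfolding fs(1)[symmetric]
  proof (rule antisym; rule lin.span_minimal)
    show "set fs \<subseteq> lin.span {pvar a - pvar b | a b. R a b}"
    proof
      fix f assume f: "f \<in> set fs"
      then have "f \<in> variable_differences ?C" using fs(2) by blast
      then obtain a b where "f = pvar a - pvar b" "a \<in> ?C" "b \<in> ?C"
        by (rule variable_differencesE)
      then show "f \<in> lin.span {pvar a - pvar b | a b. R a b}"
        using lin.span_base[OF f] unfolding R_def by (intro lin.span_base) blast
    qed
    show "{pvar a - pvar b | a b. R a b} \<subseteq> lin.span (set fs)" unfolding R_def by blast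
  qed simp_all
  finally show ?thesis using Q by blast
qed

section \<open>The partition is determined by its linear space\<close>

text \<open>Vertices of a block that have no further vertex of the block between them are the heads of
  equivalent arrows. Hence they belong to one block of every partition with at least these
  identifications.\<close>

lemma partition_rel_determines_blocks:
  assumes P: "partition_on V P" "\<forall>U\<in>P. independent_set E U"
    and Q: "partition_on V Q" and PQ: "\<And>a b. partition_rel P a b \<Longrightarrow> partition_rel Q a b"
  shows "U \<in> P \<Longrightarrow> v \<in> U \<Longrightarrow> w \<in> U \<Longrightarrow> \<exists>W\<in>Q. v \<in> W \<and> w \<in> W"
proof (induction "card (seg v w)" arbitrary: v w rule: less_induct)
  case less
  have UV: "U \<subseteq> V" using P(1) less.prems(1) by (auto simp: partition_on_def)
  show ?case
  proof (cases "v = w")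
    case True
    then show ?thesis using Q UV less.prems by (auto simp: partition_on_def)
  next
    case False
    show ?thesis
    proof (cases "seg v w \<inter> U = {v, w}")
      case True
      then have "block_rel U (arrow (step v w) v) (arrow (step w v) w)"
        using block_rel_closest[OF UV bspec[OF P(2) less.prems(1)] False] by blast
      then have "partition_rel Q (arrow (step v w) v) (arrow (step w v) w)"
        using PQ less.prems(1) unfolding partition_rel_def by blast
      then show ?thesis by (auto simp: partition_rel_def block_rel_arrow)
    next
      case F: False
      then obtain u where u: "u \<in> seg v w" "u \<in> U" "u \<noteq> v" "u \<noteq> w"
        using seg_ends[of v w] less.prems UV by blast
      then have "card (seg v u) < card (seg v w)" "card (seg u w) < card (seg v w)"
        using card_seg_less[of v w u] less.prems UV by auto
      then obtain W1 W2 where W: "W1 \<in> Q" "v \<in> W1" "u \<in> W1" "W2 \<in> Q" "u \<in> W2" "w \<in> W2"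
        using less.hyps[of v u] less.hyps[of u w] less.prems u by blast
      then have "W1 = W2" using Q by (auto simp: partition_on_def pairwise_def disjnt_def)
      then show ?thesis using W by blast
    qed
  qed
qed

lemma L_partition_inj:
  fixes P Q :: "'v set set"
  assumes P: "partition_on V P" "\<forall>U\<in>P. independent_set E U"
    and Q: "partition_on V Q" "\<forall>U\<in>Q. independent_set E U"
    and eq: "(L_partition V E P :: ('v set \<times> 'v, 'k::field) mpoly set) = L_partition V E Q"
  shows "P = Q"
proof -
  have rel: "partition_rel P a b \<longleftrightarrow> partition_rel Q a b" for a b
    using difference_in_L_partition_iff[OF P, of a b, where 'k = 'k]
      difference_in_L_partition_iff[OF Q, of a b, where 'k = 'k] partition_rel_incidence eq by metis
  have P_Q: "\<exists>W\<in>Q. v \<in> W \<and> w \<in> W" if "U \<in> P" "v \<in> U" "w \<in> U" for U v w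
    using that by (rule partition_rel_determines_blocks[OF P Q(1), rotated -3]) (simp add: rel)
  have Q_P: "\<exists>W\<in>P. v \<in> W \<and> w \<in> W" if "U \<in> Q" "v \<in> U" "w \<in> U" for U v w
    using that by (rule partition_rel_determines_blocks[OF Q P(1), rotated -3]) (simp add: rel)
  have "(\<exists>U\<in>P. v \<in> U \<and> w \<in> U) \<longleftrightarrow> (\<exists>U\<in>Q. v \<in> U \<and> w \<in> U)" for v w
    by (intro iffI; elim bexE conjE) (erule (2) P_Q, erule (2) Q_P)
  then have "{(v, w). \<exists>U\<in>P. v \<in> U \<and> w \<in> U} = {(v, w). \<exists>U\<in>Q. v \<in> U \<and> w \<in> U}" by blast
  then have "V // {(v, w). \<exists>U\<in>P. v \<in> U \<and> w \<in> U} = V // {(v, w). \<exists>U\<in>Q. v \<in> U \<and> w \<in> U}"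
    by (rule arg_cong)
  then show ?thesis unfolding partition_on_eq_quotient[OF P(1)] partition_on_eq_quotient[OF Q(1)] .
qed

end

theorem theorem6p2:
  fixes V :: "'v set" and E :: "'v set set"
  assumes "finite_tree V E"
  shows "bij_betw
    (L_partition V E :: 'v set set \<Rightarrow> ('v set \<times> 'v, 'k::field) mpoly set)
    {Q. partition_on V Q \<and> (\<forall>U\<in>Q. independent_set E U)}
    {L. regular_linear_space (incidence V E) (tree_ideal V E) L \<and>
        squarefree_quotient (incidence V E) (tree_ideal V E) L}"
proof -
  interpret ftree V E by unfold_locales fact
  show ?thesis
  proof (rule bij_betw_imageI)
    show "inj_on (L_partition V E :: 'v set set \<Rightarrow> ('v set \<times> 'v, 'k) mpoly set)
        {Q. partition_on V Q \<and> (\<forall>U\<in>Q. independent_set E U)}"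
      by (rule inj_onI) (use L_partition_inj[where 'k = 'k] in blast)
    show "(L_partition V E :: 'v set set \<Rightarrow> ('v set \<times> 'v, 'k) mpoly set) `
        {Q. partition_on V Q \<and> (\<forall>U\<in>Q. independent_set E U)} =
        {L. regular_linear_space (incidence V E) (tree_ideal V E) L \<and>
          squarefree_quotient (incidence V E) (tree_ideal V E) L}"
      using L_partition_regular_squarefree regular_squarefree_from_partition by fast
  qed
qed

end
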